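(* Let $n\ge 1$ and let $\mathbf{x}_k\sim\mathcal{N}(\boldsymbol{\mu}_{\mathbf{x}_k},\Sigma_{\mathbf{x}_k})$ and $\mathbf{s}_k\sim\mathcal{N}(\boldsymbol{\mu}_{\mathbf{s}_k},\Sigma_{\mathbf{s}_k})$ be independent Gaussian random vectors in $\mathbb{R}^n$ (the positions of the centres of a spherical robot of radius $r_1>0$ and of a spherical obstacle of radius $s_1>0$), with $\Sigma:=\Sigma_{\mathbf{x}_k}+\Sigma_{\mathbf{s}_k}$ positive definite. Put $\boldsymbol{\mu}:=\boldsymbol{\mu}_{\mathbf{x}_k}-\boldsymbol{\mu}_{\mathbf{s}_k}$ and $y:=(r_1+s_1)^2$. Then the collision probability $P(\mathcal{C}_{\mathbf{x}_k,\mathbf{s}_k}):=P\left(\|\mathbf{x}_k-\mathbf{s}_k\|^2\le (r_1+s_1)^2\right)$ is given by the convergent series $$P(\mathcal{C}_{\mathbf{x}_k,\mathbf{s}_k})=\sum_{j=0}^{\infty}(-1)^j c_j\,\frac{y^{\frac n2+j}}{\Gamma\left(\frac n2+j+1\right)},$$ where the coefficients $c_j$ are those defined in the context from $\Sigma$ and $\boldsymbol{\mu}$.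
   Context: $\|\cdot\|$ is the Euclidean norm and $\Gamma$ is the gamma function. Let $\lambda_1,\dots,\lambda_n>0$ be the eigenvalues of $\Sigma$, let $P$ be an orthogonal matrix with $P^T\Sigma P=\mathrm{diag}(\lambda_1,\dots,\lambda_n)$, and let $(b_1,\dots,b_n)^T:=P^T\Sigma^{-1/2}\boldsymbol{\mu}$. Define $$c_0=\exp\left(-\tfrac12\sum_{i=1}^n b_i^2\right)\prod_{i=1}^n(2\lambda_i)^{-1/2},\qquad d_k=\tfrac12\sum_{i=1}^n(1-kb_i^2)(2\lambda_i)^{-k}\quad(k\ge1),$$ $$c_k=\frac1k\sum_{j=0}^{k-1}d_{k-j}\,c_j\quad(k\ge1).$$ *)

theory Defs
  imports "HOL-Probability.Probability"
begin

definition psd_matrix :: "real^'n^'n \<Rightarrow> bool" where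
  "psd_matrix A \<longleftrightarrow> transpose A = A \<and> (\<forall>u. 0 \<le> u \<bullet> (A *v u))"

definition pd_matrix :: "real^'n^'n \<Rightarrow> bool" where
  "pd_matrix A \<longleftrightarrow> transpose A = A \<and> (\<forall>u. u \<noteq> 0 \<longrightarrow> 0 < u \<bullet> (A *v u))"

definition diag_matrix :: "('n \<Rightarrow> real) \<Rightarrow> real^'n^'n" where
  "diag_matrix l = (\<chi> i j. if i = j then l i else 0)"

(* Only meaningful for positive semidefinite A, which has exactly one such root. *)
definition matrix_sqrt :: "real^'n^'n \<Rightarrow> real^'n^'n" where
  "matrix_sqrt A = (THE R. psd_matrix R \<and> R ** R = A)"

(* The second parameter is the variance; variance 0 gives the point mass at the mean
   (the library's normal_density takes a standard deviation and is 0 when that is 0). *)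
definition normal_law :: "real \<Rightarrow> real \<Rightarrow> real measure" where
  "normal_law m v =
     (if v = 0 then return borel m
      else density lborel (\<lambda>x. ennreal (normal_density m (sqrt v) x)))"

(* X ~ N(mu, S) in the sense that every linear functional u . X is univariate normal with mean
   u . mu and variance u . S u. Unlike a definition by densities, this covers singular S. *)
definition gaussian_vector ::
    "'w measure \<Rightarrow> ('w \<Rightarrow> real^'n) \<Rightarrow> real^'n \<Rightarrow> real^'n^'n \<Rightarrow> bool" where
  "gaussian_vector M X mu S \<longleftrightarrow>
     X \<in> borel_measurable M \<and> psd_matrix S \<and>
     (\<forall>u. distr M borel (\<lambda>w. u \<bullet> X w) = normal_law (u \<bullet> mu) (u \<bullet> (S *v u)))"

definition d_coef :: "('n::finite \<Rightarrow> real) \<Rightarrow> real^'n \<Rightarrow> nat \<Rightarrow> real" where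
  "d_coef l b k = 1/2 * (\<Sum>i\<in>UNIV. (1 - real k * (b $ i)\<^sup>2) * inverse ((2 * l i) ^ k))"

fun c_coef :: "('n::finite \<Rightarrow> real) \<Rightarrow> real^'n \<Rightarrow> nat \<Rightarrow> real" where
  "c_coef l b 0 = exp (- (1/2) * (\<Sum>i\<in>UNIV. (b $ i)\<^sup>2)) * (\<Prod>i\<in>UNIV. (2 * l i) powr (- (1/2)))"
| "c_coef l b (Suc k) = 1 / real (Suc k) * (\<Sum>j<Suc k. d_coef l b (Suc k - j) * c_coef l b j)"

end

(* For t > 0 the Laplace transform E exp(-t |x - s|^2) is a product over the eigenvalues of Sigma of
   (1 + 2 t lam)^(-1/2) exp(-t m^2 / (1 + 2 t lam)), where m is a component of P^T mu. The recursion for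
   the c_k says that C(z) = sum c_k z^k satisfies C' = D C with D(z) = sum d_(k+1) z^k, which gives C in
   closed form; the termwise Laplace transform of the claimed series is t^(-n/2-1) C(-1/t), and this is
   the product above divided by t, that is, the Laplace transform of the distribution function of
   |x - s|^2. Both functions are right continuous, so they agree by uniqueness of Laplace transforms. *)
theory Submission
  imports Defs
begin

subsection \<open>The square root of a diagonalized matrix\<close>

text \<open>The covariances of x and s may be singular, so the two vectors need not have densities,
  and \<open>gaussian_vector\<close> gives only the laws of linear functionals. All probabilistic
  information therefore passes through characteristic functions. The product over the eigenvalues
  comes from averaging over independent Gaussian frequencies, without first showing that the rotated
  coordinates of x - s are independent. The bound |c_k| \<le> c_0 Q^k gives convergence of C(z) only
  for |z| < 1/Q, so the two transforms are compared only for t > Q. Uniqueness must work from such a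
  half line. Equally spaced values of t suffice: with u = exp(-x) they become moments on [0,1], and
  polynomials are dense among the continuous functions there. A separate obstacle is b, which is
  built from \<open>matrix_sqrt\<close> and \<open>matrix_inv\<close>, both given by choice
  operators. It enters the argument only through lam_i b_i^2 = m_i^2, and this needs the square root
  in explicit form.\<close>

lemma diag_matrix_mult_vec [simp]: "(diag_matrix l *v v) $ i = l i * v $ i"
  by (simp add: diag_matrix_def matrix_vector_mult_def if_distrib if_distribR cong: if_cong)

lemma inner_matrix_mult_vec:
  fixes A :: "real^'m^'n"
  shows "(A *v v) \<bullet> w = v \<bullet> (transpose A *v w)"
  by (metis dot_lmul_matrix vector_transpose_matrix)

lemma quadratic_form_diagonalized:
  fixes S P :: "real^'n^'n"
  assumes "transpose P ** S ** P = diag_matrix l"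
  shows "(P *v v) \<bullet> (S *v (P *v v)) = (\<Sum>i\<in>UNIV. l i * (v $ i)\<^sup>2)"
proof -
  have "(P *v v) \<bullet> (S *v (P *v v)) = v \<bullet> (diag_matrix l *v v)"
    by (simp add: inner_matrix_mult_vec matrix_vector_mul_assoc assms matrix_mul_assoc)
  then show ?thesis
    by (simp add: inner_vec_def power2_eq_square mult_ac)
qed

lemma pd_matrix_eigenvalues_pos:
  fixes S P :: "real^'n^'n"
  assumes "pd_matrix S" "orthogonal_matrix P" "transpose P ** S ** P = diag_matrix l"
  shows "0 < l i"
proof -
  have "transpose P *v (P *v axis i 1) = axis i 1"
    using assms(2) by (simp add: matrix_vector_mul_assoc orthogonal_matrix_def)
  then have "P *v axis i 1 \<noteq> 0"
    by (metis axis_eq_0_iff matrix_vector_mult_0_right zero_neq_one)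
  with assms(1) have "0 < (P *v axis i 1) \<bullet> (S *v (P *v axis i 1))"
    by (simp add: pd_matrix_def)
  also have "\<dots> = (\<Sum>j\<in>UNIV. l j * (axis i 1 $ j)\<^sup>2)"
    by (rule quadratic_form_diagonalized[OF assms(3)])
  also have "\<dots> = (\<Sum>j\<in>UNIV. if j = i then l j else 0)"
    by (rule sum.cong) (auto simp: axis_def)
  finally show ?thesis by simp
qed

lemma diag_matrix_mult_diag_matrix:
  "diag_matrix k ** diag_matrix l = diag_matrix (\<lambda>i. k i * l i)"
proof -
  have "(\<Sum>p\<in>UNIV. (if i = p then k i else 0) * (if p = j then l p else 0))
      = (\<Sum>p\<in>UNIV. if p = i then (if i = j then k i * l i else 0) else 0)" for i j
    by (rule sum.cong) auto
  then show ?thesis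
    by (simp add: diag_matrix_def matrix_matrix_mult_def vec_eq_iff)
qed

lemma transpose_diag_matrix [simp]: "transpose (diag_matrix l) = diag_matrix l"
  by (auto simp: diag_matrix_def transpose_def vec_eq_iff)

text \<open>The hypothesis says (R + c)(R - c) v = 0. Hence q = R v - c v satisfies R q = -c q, and
  a positive semidefinite R has no eigenvector for a negative eigenvalue.\<close>

lemma psd_square_root_eigenvector:
  fixes R :: "real^'n^'n"
  assumes "psd_matrix R" "R *v (R *v v) = (c\<^sup>2) *\<^sub>R v" "0 < c"
  shows "R *v v = c *\<^sub>R v"
proof -
  define q where "q = R *v v - c *\<^sub>R v"
  have "R *v q = - c *\<^sub>R q"
    by (simp add: q_def matrix_vector_mult_diff_distrib matrix_vector_mult_scaleR assms(2)
        algebra_simps power2_eq_square)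
  then have "q \<bullet> (R *v q) = - (c * (q \<bullet> q))" by simp
  moreover have "0 \<le> q \<bullet> (R *v q)" using assms(1) by (simp add: psd_matrix_def)
  ultimately have "q \<bullet> q \<le> 0" using assms(3) by (simp add: mult_le_0_iff)
  then have "q = 0" by (metis inner_eq_zero_iff inner_ge_zero order_antisym)
  then show ?thesis by (simp add: q_def)
qed

lemma matrix_eqI_on_orthogonal_columns:
  fixes A B P :: "real^'n^'n"
  assumes "orthogonal_matrix P" "\<And>i. A *v (P *v axis i 1) = B *v (P *v axis i 1)"
  shows "A = B"
proof -
  have "column i (A ** P) = column i (B ** P)" for i
    using assms(2)[of i] by (metis matrix_vector_mul_assoc matrix_vector_mult_basis)
  then have "A ** P = B ** P"
    by (simp add: vec_eq_iff column_def)
  then have "A ** P ** transpose P = B ** P ** transpose P" by simp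
  then show ?thesis
    using assms(1) by (simp add: orthogonal_matrix_def flip: matrix_mul_assoc)
qed

text \<open>The definite description must be resolved by uniqueness: the columns of P are
  eigenvectors of S = R R, so every positive semidefinite root R acts on the i-th column as
  multiplication by sqrt (l i).\<close>

lemma matrix_sqrt_diagonalized:
  fixes S P :: "real^'n^'n"
  assumes pd: "pd_matrix S" and P: "orthogonal_matrix P"
    and diag: "transpose P ** S ** P = diag_matrix l"
  shows "matrix_sqrt S = P ** diag_matrix (\<lambda>i. sqrt (l i)) ** transpose P"
proof -
  define D where "D = diag_matrix (\<lambda>i. sqrt (l i))"
  have l: "0 < l i" for i
    using pd_matrix_eigenvalues_pos[OF assms] .
  have PP: "transpose P ** P = mat 1" "P ** transpose P = mat 1"
    using P by (auto simp: orthogonal_matrix_def)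
  have "P ** (transpose P ** S ** P) ** transpose P = (P ** transpose P) ** S ** (P ** transpose P)"
    by (simp only: matrix_mul_assoc)
  then have S: "S = P ** diag_matrix l ** transpose P"
    by (simp add: PP diag)
  have DD: "D ** D = diag_matrix l"
    using l by (simp add: D_def diag_matrix_mult_diag_matrix less_imp_le)
  have sq: "(P ** D ** transpose P) ** (P ** D ** transpose P) = S"
  proof -
    have "(P ** D ** transpose P) ** (P ** D ** transpose P)
        = P ** D ** (transpose P ** P) ** D ** transpose P"
      by (simp only: matrix_mul_assoc)
    also have "\<dots> = P ** (D ** D) ** transpose P"
      by (simp add: PP matrix_mul_assoc)
    finally show ?thesis by (simp add: DD S)
  qed
  have psd: "psd_matrix (P ** D ** transpose P)"
    unfolding psd_matrix_def
  proof (intro conjI allI)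
    show "transpose (P ** D ** transpose P) = P ** D ** transpose P"
      by (simp add: matrix_transpose_mul D_def matrix_mul_assoc)
    fix u :: "real^'n"
    have "u \<bullet> ((P ** D ** transpose P) *v u) = (transpose P *v u) \<bullet> (D *v (transpose P *v u))"
      by (simp only: inner_matrix_mult_vec transpose_transpose matrix_vector_mul_assoc matrix_mul_assoc)
    also have "\<dots> = (\<Sum>i\<in>UNIV. sqrt (l i) * ((transpose P *v u) $ i)\<^sup>2)"
      by (simp add: D_def inner_vec_def power2_eq_square mult_ac)
    also have "0 \<le> \<dots>"
      using l by (intro sum_nonneg mult_nonneg_nonneg) (auto simp: less_imp_le)
    finally show "0 \<le> u \<bullet> ((P ** D ** transpose P) *v u)" .
  qed
  have uniq: "R = P ** D ** transpose P" if R: "psd_matrix R \<and> R ** R = S" for R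
  proof (rule matrix_eqI_on_orthogonal_columns[OF P])
    fix i
    have ax: "diag_matrix k *v axis i 1 = k i *\<^sub>R axis i 1" for k :: "'n \<Rightarrow> real"
      by (auto simp: vec_eq_iff axis_def)
    have "R *v (R *v (P *v axis i 1)) = S *v (P *v axis i 1)"
      using R by (metis matrix_vector_mul_assoc)
    also have "\<dots> = P *v (diag_matrix l *v ((transpose P ** P) *v axis i 1))"
      by (subst S) (simp only: matrix_vector_mul_assoc matrix_mul_assoc)
    also have "\<dots> = (sqrt (l i))\<^sup>2 *\<^sub>R (P *v axis i 1)"
      using l[of i] by (simp add: PP ax matrix_vector_mult_scaleR)
    finally have "R *v (P *v axis i 1) = sqrt (l i) *\<^sub>R (P *v axis i 1)"
      by (rule psd_square_root_eigenvector[rotated]) (use R l in auto)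
    also have "\<dots> = P *v (D *v ((transpose P ** P) *v axis i 1))"
      by (simp add: PP D_def ax matrix_vector_mult_scaleR)
    also have "\<dots> = (P ** D ** transpose P) *v (P *v axis i 1)"
      by (simp only: matrix_vector_mul_assoc matrix_mul_assoc)
    finally show "R *v (P *v axis i 1) = (P ** D ** transpose P) *v (P *v axis i 1)" .
  qed
  show ?thesis
    unfolding matrix_sqrt_def D_def[symmetric]
    using psd sq uniq by (intro the_equality) blast+
qed

lemma standardized_mean_component:
  fixes S P :: "real^'n^'n"
  assumes pd: "pd_matrix S" and P: "orthogonal_matrix P"
    and diag: "transpose P ** S ** P = diag_matrix l"
  shows "(transpose P *v (matrix_inv (matrix_sqrt S) *v mu)) $ i = (transpose P *v mu) $ i / sqrt (l i)"
proof -
  define D where "D = diag_matrix (\<lambda>i. sqrt (l i))"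
  define E where "E = diag_matrix (\<lambda>i. inverse (sqrt (l i)))"
  have l: "0 < l i" for i
    using pd_matrix_eigenvalues_pos[OF assms] .
  have PP: "transpose P ** P = mat 1" "P ** transpose P = mat 1"
    using P by (auto simp: orthogonal_matrix_def)
  have "diag_matrix (\<lambda>_. 1) = mat 1"
    by (simp add: diag_matrix_def mat_def)
  then have DE: "D ** E = mat 1"
    using l by (simp add: D_def E_def diag_matrix_mult_diag_matrix less_imp_neq[THEN not_sym])
  have "(P ** D ** transpose P) ** (P ** E ** transpose P)
      = P ** D ** (transpose P ** P) ** E ** transpose P"
    by (simp only: matrix_mul_assoc)
  also have "\<dots> = P ** (D ** E) ** transpose P"
    by (simp add: PP matrix_mul_assoc)
  finally have right: "(P ** D ** transpose P) ** (P ** E ** transpose P) = mat 1"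
    by (simp add: DE PP)
  then have left: "(P ** E ** transpose P) ** (P ** D ** transpose P) = mat 1"
    by (rule matrix_left_right_inverse[THEN iffD1])
  define A where "A = P ** D ** transpose P"
  define B where "B = P ** E ** transpose P"
  have AB: "A ** B = mat 1" "B ** A = mat 1"
    using left right by (simp_all add: A_def B_def)
  \<comment> \<open>\<open>matrix_inv\<close> is a choice, so it satisfies the inverse equations
    only once some inverse is exhibited. Uniqueness of inverses then identifies it with B.\<close>
  then have "\<exists>A'. A ** A' = mat 1 \<and> A' ** A = mat 1" by blast
  then have "A ** matrix_inv A = mat 1 \<and> matrix_inv A ** A = mat 1"
    unfolding matrix_inv_def by (rule someI_ex)
  then have "matrix_inv A = B"
    by (metis AB matrix_mul_assoc matrix_mul_lid matrix_mul_rid)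
  moreover have "matrix_sqrt S = A"
    using matrix_sqrt_diagonalized[OF assms] by (simp add: A_def D_def)
  ultimately have "transpose P *v (matrix_inv (matrix_sqrt S) *v mu)
      = ((transpose P ** P) ** E ** transpose P) *v mu"
    by (simp add: B_def matrix_vector_mul_assoc matrix_mul_assoc)
  also have "\<dots> = E *v (transpose P *v mu)"
    by (simp only: PP matrix_vector_mul_assoc matrix_mul_lid)
  finally show ?thesis
    by (simp add: E_def field_simps del: transpose_matrix_vector)
qed

subsection \<open>Gaussian vectors\<close>

text \<open>The point mass at variance 0 obeys the same formula as the nondegenerate laws, so
  singular covariances need no separate treatment later.\<close>

lemma char_normal_law:
  assumes "0 \<le> v"
  shows "char (normal_law m v) t = exp (\<i> * complex_of_real (t * m) - complex_of_real (v * t\<^sup>2 / 2))"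
proof (cases "v = 0")
  case True
  then show ?thesis
    by (simp add: normal_law_def char_def integral_return)
next
  case False
  with assms have v: "0 < v" by simp
  have std: "(CLINT x|lborel. std_normal_density x *\<^sub>R iexp (r * x)) = exp (- (r\<^sup>2) / 2)" for r
    using fun_cong[OF char_std_normal_distribution, of r]
    by (simp add: char_def integral_density)
  have "char (normal_law m v) t = (CLINT x|lborel. normal_density m (sqrt v) x *\<^sub>R iexp (t * x))"
    using v by (simp add: normal_law_def char_def integral_density)
  also have "\<dots> = \<bar>sqrt v\<bar> *\<^sub>R (CLINT x|lborel. normal_density m (sqrt v) (m + sqrt v * x) *\<^sub>R iexp (t * (m + sqrt v * x)))"
    using v by (intro lborel_integral_real_affine) simp
  also have "(\<lambda>x. normal_density m (sqrt v) (m + sqrt v * x) *\<^sub>R iexp (t * (m + sqrt v * x)))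
     = (\<lambda>x. (iexp (t * m) / sqrt v) * (std_normal_density x *\<^sub>R iexp ((t * sqrt v) * x)))"
    using v by (auto simp: fun_eq_iff normal_density_def real_sqrt_mult power_mult_distrib
        scaleR_conv_of_real field_simps exp_add[symmetric])
  also have "\<bar>sqrt v\<bar> *\<^sub>R (CLINT x|lborel. (iexp (t * m) / sqrt v) * (std_normal_density x *\<^sub>R iexp ((t * sqrt v) * x)))
     = iexp (t * m) * exp (- ((t * sqrt v)\<^sup>2) / 2)"
    using v by (simp only: integral_mult_right_zero std) (simp add: scaleR_conv_of_real)
  also have "- ((t * sqrt v)\<^sup>2) / 2 = - (v * t\<^sup>2 / 2)"
    using v by (simp add: power_mult_distrib)
  also have "iexp (t * m) * complex_of_real (exp (- (v * t\<^sup>2 / 2)))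
      = exp (\<i> * complex_of_real (t * m) - complex_of_real (v * t\<^sup>2 / 2))"
    by (simp only: exp_of_real[symmetric] exp_add[symmetric] of_real_minus diff_conv_add_uminus)
  finally show ?thesis .
qed

text \<open>The damping factor times the standard normal density is sqrt s times the density of N(0,
  s) with s = 1 / (1 + l), so the integral is again a characteristic function.\<close>

lemma integral_std_normal_iexp_gaussian:
  assumes "0 \<le> l"
  shows "(CLINT x|std_normal_distribution. iexp (m * x) * complex_of_real (exp (- (l * x\<^sup>2 / 2))))
     = complex_of_real ((1 + l) powr (- (1/2)) * exp (- (m\<^sup>2 / (2 * (1 + l)))))"
proof -
  define s where "s = 1 / (1 + l)"
  have s: "0 < s" using assms by (simp add: s_def)
  have p: "(1 + l) powr (- (1/2)) = sqrt s"
    using assms by (simp add: s_def powr_minus powr_half_sqrt real_sqrt_divide field_simps)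
  have nd: "std_normal_density x * exp (- (l * x\<^sup>2 / 2)) = sqrt s * normal_density 0 (sqrt s) x" for x
  proof -
    have "- x\<^sup>2 / 2 + - (l * x\<^sup>2 / 2) = - x\<^sup>2 / (2 * s)"
      using assms by (simp add: s_def field_simps)
    then have "exp (- x\<^sup>2 / 2) * exp (- (l * x\<^sup>2 / 2)) = exp (- x\<^sup>2 / (2 * s))"
      by (metis exp_add)
    then show ?thesis
      using s by (simp add: normal_density_def real_sqrt_mult field_simps)
  qed
  have "(CLINT x|std_normal_distribution. iexp (m * x) * complex_of_real (exp (- (l * x\<^sup>2 / 2))))
    = (CLINT x|lborel. std_normal_density x *\<^sub>R (iexp (m * x) * complex_of_real (exp (- (l * x\<^sup>2 / 2)))))"
    by (subst integral_density) auto
  also have "(\<lambda>x. std_normal_density x *\<^sub>R (iexp (m * x) * complex_of_real (exp (- (l * x\<^sup>2 / 2)))))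
    = (\<lambda>x. complex_of_real (sqrt s) * (normal_density 0 (sqrt s) x *\<^sub>R iexp (m * x)))"
  proof
    fix x
    have "std_normal_density x *\<^sub>R (iexp (m * x) * complex_of_real (exp (- (l * x\<^sup>2 / 2))))
       = complex_of_real (std_normal_density x * exp (- (l * x\<^sup>2 / 2))) * iexp (m * x)"
      by (simp add: scaleR_conv_of_real mult_ac)
    then show "std_normal_density x *\<^sub>R (iexp (m * x) * complex_of_real (exp (- (l * x\<^sup>2 / 2))))
       = complex_of_real (sqrt s) * (normal_density 0 (sqrt s) x *\<^sub>R iexp (m * x))"
      by (simp only: nd) (simp add: scaleR_conv_of_real mult_ac)
  qed
  also have "(CLINT x|lborel. complex_of_real (sqrt s) * (normal_density 0 (sqrt s) x *\<^sub>R iexp (m * x)))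
     = complex_of_real (sqrt s) * char (normal_law 0 s) m"
    using s by (simp only: integral_mult_right_zero) (simp add: normal_law_def char_def integral_density)
  also have "char (normal_law 0 s) m = complex_of_real (exp (- (s * m\<^sup>2 / 2)))"
    using s by (subst char_normal_law) (auto simp flip: exp_of_real)
  also have "s * m\<^sup>2 / 2 = m\<^sup>2 / (2 * (1 + l))"
    by (simp add: s_def)
  finally show ?thesis by (simp add: p)
qed

lemma sum_components_orthogonal:
  fixes P :: "real^'n^'n"
  assumes "orthogonal_matrix P"
  shows "(\<Sum>i\<in>UNIV. ((transpose P *v z) $ i)\<^sup>2) = (norm z)\<^sup>2"
proof -
  have "(transpose P *v z) \<bullet> (transpose P *v z) = z \<bullet> z"
    using assms by (simp add: inner_matrix_mult_vec matrix_vector_mul_assoc orthogonal_matrix_def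
        del: transpose_matrix_vector)
  then show ?thesis
    by (simp add: power2_norm_eq_inner) (simp add: inner_vec_def power2_eq_square)
qed

text \<open>If \<open>G\<close> is a standard normal vector independent of \<open>X\<close>, then \<open>exp (-t \<bar>X\<bar>\<^sup>2)\<close> is the
  conditional expectation of \<open>iexp (sqrt (2 t) G \<bullet> X)\<close> given \<open>X\<close>; integrating over \<open>X\<close> first
  instead brings in only the characteristic function of \<open>X\<close>.\<close>

lemma (in prob_space) laplace_transform_norm_square:
  fixes X :: "'a \<Rightarrow> real^'n" and S P :: "real^'n^'n"
  assumes X [measurable]: "X \<in> borel_measurable M"
    and char: "\<And>u. (CLINT w|M. iexp (u \<bullet> X w))
        = exp (\<i> * complex_of_real (u \<bullet> mu) - complex_of_real (u \<bullet> (S *v u) / 2))"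
    and P: "orthogonal_matrix P" and diag: "transpose P ** S ** P = diag_matrix l"
    and l: "\<And>i. 0 \<le> l i" and t: "0 \<le> t"
  shows "(LINT w|M. exp (- (t * (norm (X w))\<^sup>2)))
     = (\<Prod>i\<in>UNIV. (1 + 2 * t * l i) powr (- (1/2))
          * exp (- (t * ((transpose P *v mu) $ i)\<^sup>2 / (1 + 2 * t * l i))))"
proof -
  interpret std: prob_space std_normal_distribution
    by (rule prob_space_normal_density) simp
  define N :: "('n \<Rightarrow> real) measure" where "N = Pi\<^sub>M UNIV (\<lambda>_. std_normal_distribution)"
  interpret prod: product_prob_space "\<lambda>_::'n. std_normal_distribution" UNIV ..
  interpret N: prob_space N
    unfolding N_def by (rule prod.prob_space_axioms)
  interpret MN: pair_sigma_finite M N ..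
  \<comment> \<open>The characteristic function of a standard normal variable at a W_i is exp (-a^2
    W_i^2 / 2), which is exp (-t W_i^2) for a^2 = 2 t.\<close>
  define a where "a = sqrt (2 * t)"
  have a2: "a\<^sup>2 = 2 * t" using t by (simp add: a_def)
  define W where "W w = transpose P *v X w" for w
  define m where "m = transpose P *v mu"
  have W [measurable]: "(\<lambda>w. W w $ i) \<in> borel_measurable M" for i
  proof -
    have "(\<lambda>w. (transpose P *v X w) $ i) = (\<lambda>w. \<Sum>j\<in>UNIV. transpose P $ i $ j * X w $ j)"
      by (simp add: matrix_vector_mult_def)
    also have "\<dots> \<in> borel_measurable M"
      by (intro borel_measurable_sum borel_measurable_times borel_measurable_const
          measurable_compose[OF X] borel_measurable_continuous_onI) (intro continuous_intros)
    finally show ?thesis by (simp add: W_def)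
  qed
  have comp [measurable]: "(\<lambda>g. g i) \<in> borel_measurable N" for i
  proof -
    have "(\<lambda>g. g i) \<in> N \<rightarrow>\<^sub>M std_normal_distribution"
      unfolding N_def by measurable
    then show ?thesis by simp
  qed
  \<comment> \<open>The random frequency is the rotated vector P g, with g distributed as the
    product measure N. The rotation moves over to X, and the exponent becomes a sum over the
    coordinates of g.\<close>
  have inner: "(P *v (\<chi> i. a * g i)) \<bullet> X w = (\<Sum>i\<in>UNIV. a * g i * W w $ i)" for g w
    by (simp add: inner_matrix_mult_vec W_def) (simp add: inner_vec_def)
  have inner_mu: "(P *v (\<chi> i. a * g i)) \<bullet> mu = (\<Sum>i\<in>UNIV. a * g i * m $ i)" for g
    by (simp add: inner_matrix_mult_vec m_def) (simp add: inner_vec_def)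
  define f where "f w g = iexp (\<Sum>i\<in>UNIV. a * g i * W w $ i)" for w g
  have meas: "(\<lambda>(w, g). f w g) \<in> borel_measurable (M \<Otimes>\<^sub>M N)"
    unfolding f_def by measurable
  have int: "integrable (M \<Otimes>\<^sub>M N) (\<lambda>(w, g). f w g)"
  proof -
    interpret MNp: pair_prob_space M N ..
    show ?thesis
      by (rule MNp.integrable_const_bound[where B = 1, OF _ meas]) (auto simp: f_def)
  qed
  have expi: "iexp (\<Sum>i\<in>UNIV. h i) = (\<Prod>i\<in>UNIV. iexp (h i))" for h :: "'n \<Rightarrow> real"
    by (simp add: sum_distrib_left exp_sum)
  have left: "(CLINT g|N. f w g) = complex_of_real (exp (- (t * (norm (X w))\<^sup>2)))" for w
  proof -
    have "(CLINT g|N. f w g) = (CLINT g|N. (\<Prod>i\<in>UNIV. iexp (a * W w $ i * g i)))"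
      unfolding f_def expi by (simp add: mult_ac)
    also have "\<dots> = (\<Prod>i\<in>UNIV. CLINT x|std_normal_distribution. iexp (a * W w $ i * x))"
      unfolding N_def by (rule prod.product_integral_prod) (auto intro!: std.integrable_iexp)
    also have "\<dots> = (\<Prod>i\<in>UNIV. complex_of_real (exp (- (t * (W w $ i)\<^sup>2))))"
    proof (rule prod.cong)
      fix i
      have "(CLINT x|std_normal_distribution. iexp (a * W w $ i * x))
         = char std_normal_distribution (a * W w $ i)"
        by (simp add: char_def)
      also have "\<dots> = complex_of_real (exp (- (t * (W w $ i)\<^sup>2)))"
        by (simp only: char_std_normal_distribution) (simp add: power_mult_distrib a2)
      finally show "(CLINT x|std_normal_distribution. iexp (a * W w $ i * x)) = \<dots>" .
    qed simp
    also have "\<dots> = complex_of_real (exp (- (t * (\<Sum>i\<in>UNIV. (W w $ i)\<^sup>2))))"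
      by (simp add: sum_distrib_left exp_sum flip: sum_negf of_real_prod)
    finally show ?thesis
      by (simp only: W_def sum_components_orthogonal[OF P])
  qed
  \<comment> \<open>For frequencies P g the quadratic form of S is diagonal, so the characteristic
    function of X splits into one factor for each g i, and the integral over N becomes a product of
    one-dimensional integrals.\<close>
  have right: "(CLINT w|M. f w g)
     = (\<Prod>i\<in>UNIV. iexp (a * m $ i * g i) * complex_of_real (exp (- (2 * t * l i * (g i)\<^sup>2 / 2))))" for g
  proof -
    have "(CLINT w|M. f w g) = exp (\<i> * complex_of_real (\<Sum>i\<in>UNIV. a * g i * m $ i)
        - complex_of_real ((\<Sum>i\<in>UNIV. l i * (a * g i)\<^sup>2) / 2))"
      unfolding f_def using char[of "P *v (\<chi> i. a * g i)"]
      by (simp only: inner inner_mu quadratic_form_diagonalized[OF diag] vec_lambda_beta)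
    also have "(\<Sum>i\<in>UNIV. l i * (a * g i)\<^sup>2) / 2 = (\<Sum>i\<in>UNIV. 2 * t * l i * (g i)\<^sup>2 / 2)"
      by (simp add: sum_divide_distrib power_mult_distrib a2 mult_ac)
    also have "exp (\<i> * complex_of_real (\<Sum>i\<in>UNIV. a * g i * m $ i)
          - complex_of_real (\<Sum>i\<in>UNIV. 2 * t * l i * (g i)\<^sup>2 / 2))
       = iexp (\<Sum>i\<in>UNIV. a * g i * m $ i) * complex_of_real (exp (- (\<Sum>i\<in>UNIV. 2 * t * l i * (g i)\<^sup>2 / 2)))"
      by (simp only: exp_of_real[symmetric] exp_add[symmetric] of_real_minus diff_conv_add_uminus)
    also have "\<dots> = (\<Prod>i\<in>UNIV. iexp (a * g i * m $ i)) * (\<Prod>i\<in>UNIV. complex_of_real (exp (- (2 * t * l i * (g i)\<^sup>2 / 2))))"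
      by (simp only: expi sum_negf[symmetric] exp_sum[OF finite] of_real_prod finite)
    finally show ?thesis
      by (simp only: prod.distrib mult_ac)
  qed
  have "complex_of_real (LINT w|M. exp (- (t * (norm (X w))\<^sup>2))) = (CLINT w|M. (CLINT g|N. f w g))"
    by (simp only: left integral_complex_of_real)
  also have "\<dots> = (CLINT g|N. (CLINT w|M. f w g))"
    by (rule MN.Fubini_integral[OF int, symmetric])
  also have "\<dots> = (\<Prod>i\<in>UNIV. CLINT x|std_normal_distribution.
       iexp (a * m $ i * x) * complex_of_real (exp (- (2 * t * l i * x\<^sup>2 / 2))))"
    unfolding right N_def
  proof (rule prod.product_integral_prod)
    fix i
    show "integrable std_normal_distribution
       (\<lambda>x. iexp (a * m $ i * x) * complex_of_real (exp (- (2 * t * l i * x\<^sup>2 / 2))))"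
      using t l by (intro std.integrable_const_bound[where B = 1]) (auto simp: norm_mult)
  qed simp
  also have "\<dots> = (\<Prod>i\<in>UNIV. complex_of_real ((1 + 2 * t * l i) powr (- (1/2))
          * exp (- (t * (m $ i)\<^sup>2 / (1 + 2 * t * l i)))))"
  proof (rule prod.cong)
    fix i
    have half: "2 * x / (2 * y) = x / y" for x y :: real by simp
    have "(a * m $ i)\<^sup>2 / (2 * (1 + 2 * t * l i)) = t * (m $ i)\<^sup>2 / (1 + 2 * t * l i)"
      by (simp only: power_mult_distrib a2 mult.assoc half)
    then show "(CLINT x|std_normal_distribution.
       iexp (a * m $ i * x) * complex_of_real (exp (- (2 * t * l i * x\<^sup>2 / 2)))) =
       complex_of_real ((1 + 2 * t * l i) powr (- (1/2)) * exp (- (t * (m $ i)\<^sup>2 / (1 + 2 * t * l i))))"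
      using integral_std_normal_iexp_gaussian[of "2 * t * l i" "a * m $ i"] t l
      by (simp only: mult_nonneg_nonneg zero_le_numeral)
  qed simp
  finally show ?thesis
    unfolding of_real_prod[symmetric] of_real_eq_iff m_def .
qed

lemma (in prob_space) char_gaussian_vector:
  assumes "gaussian_vector M X mu S"
  shows "(CLINT w|M. iexp (u \<bullet> X w))
     = exp (\<i> * complex_of_real (u \<bullet> mu) - complex_of_real (u \<bullet> (S *v u) / 2))"
proof -
  have [measurable]: "X \<in> borel_measurable M" and "0 \<le> u \<bullet> (S *v u)"
    and d: "distr M borel (\<lambda>w. u \<bullet> X w) = normal_law (u \<bullet> mu) (u \<bullet> (S *v u))"
    using assms by (auto simp: gaussian_vector_def psd_matrix_def)
  have "(CLINT w|M. iexp (u \<bullet> X w)) = char (distr M borel (\<lambda>w. u \<bullet> X w)) 1"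
    by (simp add: char_def integral_distr)
  then show ?thesis
    using \<open>0 \<le> u \<bullet> (S *v u)\<close> by (simp add: d char_normal_law)
qed

text \<open>The difference contributes the frequency -u for Y. This flips the sign of the mean but
  leaves the quadratic form unchanged, so the means subtract and the covariances add.\<close>

lemma (in prob_space) char_diff_gaussian_vector:
  fixes X Y :: "'a \<Rightarrow> real^'n"
  assumes X: "gaussian_vector M X mX SX" and Y: "gaussian_vector M Y mY SY"
    and indep: "indep_var borel X borel Y"
  shows "(CLINT w|M. iexp (u \<bullet> (X w - Y w)))
     = exp (\<i> * complex_of_real (u \<bullet> (mX - mY)) - complex_of_real (u \<bullet> ((SX + SY) *v u) / 2))"
proof -
  have [measurable]: "X \<in> borel_measurable M" "Y \<in> borel_measurable M"
    using X Y by (auto simp: gaussian_vector_def)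
  have "(CLINT w|M. iexp (u \<bullet> (X w - Y w))) = (CLINT w|M. iexp (u \<bullet> X w) * iexp ((- u) \<bullet> Y w))"
    by (simp add: inner_diff_right algebra_simps flip: exp_add)
  also have "\<dots> = (CLINT w|M. iexp (u \<bullet> X w)) * (CLINT w|M. iexp ((- u) \<bullet> Y w))"
    by (intro indep_var_lebesgue_integral indep_var_compose[unfolded comp_def, OF indep] integrable_iexp)
       auto
  also have "\<dots> = exp (\<i> * complex_of_real (u \<bullet> mX) - complex_of_real (u \<bullet> (SX *v u) / 2))
      * exp (\<i> * complex_of_real ((- u) \<bullet> mY) - complex_of_real ((- u) \<bullet> (SY *v (- u)) / 2))"
    by (simp only: char_gaussian_vector[OF X] char_gaussian_vector[OF Y])
  also have "\<dots> = exp (\<i> * complex_of_real (u \<bullet> (mX - mY)) - complex_of_real (u \<bullet> ((SX + SY) *v u) / 2))"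
    by (simp add: exp_add[symmetric] inner_diff_right inner_add_right matrix_vector_mult_add_rdistrib
        vec.neg algebra_simps add_divide_distrib)
  finally show ?thesis .
qed

subsection \<open>The coefficient recursion\<close>

text \<open>By A \<ge> 1 every summand for index n + 1 is at most |c 0| (A q)^(n+1). There are n + 1
  of them, and the factor 1 / (n + 1) turns the sum into an average, so the bound does not
  deteriorate.\<close>

lemma exp_recursion_bound:
  fixes c d :: "nat \<Rightarrow> real"
  assumes rec: "\<And>k. c (Suc k) = 1 / real (Suc k) * (\<Sum>j<Suc k. d (Suc k - j) * c j)"
    and d: "\<And>k. \<bar>d k\<bar> \<le> A * q ^ k" and "0 \<le> q" "1 \<le> A"
  shows "\<bar>c k\<bar> \<le> \<bar>c 0\<bar> * (A * q) ^ k"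
proof (induction k rule: less_induct)
  case (less k)
  show ?case
  proof (cases k)
    case (Suc n)
    have summand: "\<bar>d (Suc n - j) * c j\<bar> \<le> \<bar>c 0\<bar> * (A * q) ^ Suc n" if "j < Suc n" for j
    proof -
      have "\<bar>d (Suc n - j) * c j\<bar> \<le> (A * q ^ (Suc n - j)) * (\<bar>c 0\<bar> * (A * q) ^ j)"
        unfolding abs_mult using d less[of j] that Suc assms(3,4)
        by (intro mult_mono) auto
      also have "\<dots> = \<bar>c 0\<bar> * (A ^ Suc j * q ^ (Suc n - j + j))"
        by (simp only: power_add power_mult_distrib power_Suc mult_ac)
      also have "\<dots> \<le> \<bar>c 0\<bar> * (A ^ Suc n * q ^ (Suc n - j + j))"
        using that assms(3,4) by (intro mult_left_mono mult_right_mono power_increasing) auto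
      also have "Suc n - j + j = Suc n" using that by simp
      finally show ?thesis by (simp only: power_mult_distrib)
    qed
    have "\<bar>\<Sum>j<Suc n. d (Suc n - j) * c j\<bar> \<le> (\<Sum>j<Suc n. \<bar>c 0\<bar> * (A * q) ^ Suc n)"
      by (intro order_trans[OF sum_abs] sum_mono summand) auto
    then have "\<bar>\<Sum>j<Suc n. d (Suc n - j) * c j\<bar> \<le> real (Suc n) * (\<bar>c 0\<bar> * (A * q) ^ Suc n)"
      by simp
    then have "\<bar>c (Suc n)\<bar> \<le> \<bar>c 0\<bar> * (A * q) ^ Suc n"
      unfolding rec abs_mult by (simp add: field_simps del: sum.lessThan_Suc)
    then show ?thesis by (simp only: Suc)
  qed simp
qed

text \<open>The function exp (- E z) is an integrating factor: C(z) exp (- E z) has derivative zero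
  on |z| < r, hence keeps its value c 0 at the origin.\<close>

lemma exp_recursion_generating_function:
  fixes c d :: "nat \<Rightarrow> real"
  assumes rec: "\<And>k. c (Suc k) = 1 / real (Suc k) * (\<Sum>j<Suc k. d (Suc k - j) * c j)"
    and sc: "\<And>z. \<bar>z\<bar> < r \<Longrightarrow> summable (\<lambda>k. norm (c k * z ^ k))"
    and sd: "\<And>z. \<bar>z\<bar> < r \<Longrightarrow> summable (\<lambda>k. norm (d (Suc k) * z ^ k))"
    and E: "\<And>z. \<bar>z\<bar> < r \<Longrightarrow> (E has_real_derivative (\<Sum>k. d (Suc k) * z ^ k)) (at z)"
    and "E 0 = 0" and z: "\<bar>z\<bar> < r"
  shows "(\<Sum>k. c k * z ^ k) = c 0 * exp (E z)"
proof -
  define C where "C z = (\<Sum>k. c k * z ^ k)" for z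
  define D where "D z = (\<Sum>k. d (Suc k) * z ^ k)" for z
  have C': "(C has_real_derivative D z * C z) (at z)" if z: "\<bar>z\<bar> < r" for z
  proof -
    have "(\<lambda>k. \<Sum>i\<le>k. (c i * z ^ i) * (d (Suc (k - i)) * z ^ (k - i))) sums (C z * D z)"
      unfolding C_def D_def by (intro Cauchy_product_sums sc sd z)
    \<comment> \<open>The coefficients of D start at d 1, so the k-th Cauchy coefficient is the sum
      of d (k + 1 - i) c_i over i \<le> k. By the recursion this is (k + 1) c_(k+1), the k-th
      coefficient of C'.\<close>
    also have "(\<lambda>k. \<Sum>i\<le>k. (c i * z ^ i) * (d (Suc (k - i)) * z ^ (k - i))) = (\<lambda>k. diffs c k * z ^ k)"
    proof
      fix k
      have "(\<Sum>i\<le>k. (c i * z ^ i) * (d (Suc (k - i)) * z ^ (k - i)))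
          = (\<Sum>i\<le>k. d (Suc k - i) * c i * z ^ k)"
      proof (rule sum.cong)
        fix i assume "i \<in> {..k}"
        then have "Suc (k - i) = Suc k - i" "z ^ i * z ^ (k - i) = z ^ k"
          by (auto simp flip: power_add)
        then show "(c i * z ^ i) * (d (Suc (k - i)) * z ^ (k - i)) = d (Suc k - i) * c i * z ^ k"
          by (simp add: mult_ac)
      qed simp
      also have "\<dots> = diffs c k * z ^ k"
        unfolding diffs_def rec[of k] sum_distrib_right[symmetric] lessThan_Suc_atMost by simp
      finally show "(\<Sum>i\<le>k. (c i * z ^ i) * (d (Suc (k - i)) * z ^ (k - i))) = diffs c k * z ^ k" .
    qed
    finally have "(\<Sum>k. diffs c k * z ^ k) = D z * C z"
      by (simp add: sums_iff mult.commute)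
    moreover have "(C has_real_derivative (\<Sum>k. diffs c k * z ^ k)) (at z)"
      unfolding C_def using sc z by (intro termdiffs_strong'[where K = r]) (auto intro: summable_norm_cancel)
    ultimately show ?thesis by simp
  qed
  have "((\<lambda>z. C z * exp (- E z)) has_real_derivative 0) (at z)" if "\<bar>z\<bar> < r" for z
    by (rule derivative_eq_intros C'[OF that] E[OF that] refl)+ (simp add: D_def algebra_simps)
  then have "C z * exp (- E z) = C 0 * exp (- E 0)"
    using z by (intro DERIV_isconst3[of "- r" r z 0 "\<lambda>z. C z * exp (- E z)"]) auto
  moreover have "C 0 = c 0"
    by (simp add: C_def)
  ultimately show ?thesis
    using \<open>E 0 = 0\<close> by (simp add: C_def exp_minus field_simps)
qed

section \<open>Growth and closed form of the generating function of the c_k\<close>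

text \<open>The factor k is absorbed by k \<le> 2^k, which cancels the 2^k in the denominator (2
  l_i)^k. The sum of all 1 / l_i serves as a common bound for each of them, and the leading 1 in the
  constant provides the A \<ge> 1 required by \<open>exp_recursion_bound\<close>.\<close>

lemma d_coef_bound:
  assumes l: "\<And>i. 0 < l i"
  shows "\<bar>d_coef l b k\<bar> \<le> (1 + (\<Sum>i\<in>UNIV. 1 + (b $ i)\<^sup>2)) * (\<Sum>i\<in>UNIV. 1 / l i) ^ k"
proof -
  define q where "q = (\<Sum>i\<in>UNIV. 1 / l i)"
  have q0: "0 \<le> q" using l by (auto simp: q_def less_imp_le intro!: sum_nonneg)
  have summand: "\<bar>(1 - real k * (b $ i)\<^sup>2) * inverse ((2 * l i) ^ k)\<bar> \<le> (1 + (b $ i)\<^sup>2) * q ^ k" for i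
  proof -
    have "\<bar>1 - real k * (b $ i)\<^sup>2\<bar> \<le> 1 + real k * (b $ i)\<^sup>2"
      by (intro order_trans[OF abs_triangle_ineq4]) simp
    also have "\<dots> \<le> 2 ^ k * 1 + 2 ^ k * (b $ i)\<^sup>2"
      using of_nat_mono[OF less_imp_le[OF less_exp[of k]], where 'a = real]
      by (intro add_mono mult_right_mono) auto
    finally have "\<bar>1 - real k * (b $ i)\<^sup>2\<bar> \<le> (1 + (b $ i)\<^sup>2) * 2 ^ k"
      by (simp add: algebra_simps)
    then have "\<bar>(1 - real k * (b $ i)\<^sup>2) * inverse ((2 * l i) ^ k)\<bar>
        \<le> (1 + (b $ i)\<^sup>2) * 2 ^ k * inverse ((2 * l i) ^ k)"
      using l[of i] by (simp add: abs_mult mult_right_mono)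
    also have "\<dots> = (1 + (b $ i)\<^sup>2) * (1 / l i) ^ k"
      using l[of i] by (simp add: power_mult_distrib power_divide field_simps)
    also have "\<dots> \<le> (1 + (b $ i)\<^sup>2) * q ^ k"
      using l by (intro mult_left_mono power_mono) (auto simp: q_def less_imp_le intro!: member_le_sum)
    finally show ?thesis .
  qed
  have "\<bar>d_coef l b k\<bar> \<le> \<bar>\<Sum>i\<in>UNIV. (1 - real k * (b $ i)\<^sup>2) * inverse ((2 * l i) ^ k)\<bar>"
    by (simp add: d_coef_def abs_mult)
  also have "\<dots> \<le> (\<Sum>i\<in>UNIV. (1 + (b $ i)\<^sup>2) * q ^ k)"
    by (intro order_trans[OF sum_abs] sum_mono summand)
  also have "\<dots> \<le> (1 + (\<Sum>i\<in>UNIV. 1 + (b $ i)\<^sup>2)) * q ^ k"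
    unfolding sum_distrib_right[symmetric] using q0 by (intro mult_right_mono) auto
  finally show ?thesis by (simp add: q_def)
qed

lemma summable_power_bound:
  fixes c :: "nat \<Rightarrow> real"
  assumes "\<And>k. \<bar>c k\<bar> \<le> K * Q ^ k" "0 \<le> Q" "\<bar>z\<bar> * Q < 1"
  shows "summable (\<lambda>k. norm (c k * z ^ k))"
proof (rule summable_comparison_test')
  show "summable (\<lambda>k. K * (\<bar>z\<bar> * Q) ^ k)"
    using assms by (intro summable_mult summable_geometric) (simp add: abs_mult)
  fix k
  have "\<bar>c k\<bar> * \<bar>z\<bar> ^ k \<le> K * Q ^ k * \<bar>z\<bar> ^ k"
    using assms(1) by (intro mult_right_mono) auto
  then show "norm (norm (c k * z ^ k)) \<le> K * (\<bar>z\<bar> * Q) ^ k"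
    by (simp add: abs_mult power_abs power_mult_distrib mult_ac)
qed

text \<open>With a_i = 1 / (2 l_i), the part of d_(k+1) z^k without b is a geometric series in a_i
  z, and the part with the factor k + 1 is the derivative of one.\<close>

lemma d_coef_sums:
  assumes l: "\<And>i. 0 < l i" and z: "\<And>i. \<bar>z / (2 * l i)\<bar> < 1"
  shows "(\<lambda>k. d_coef l b (Suc k) * z ^ k) sums
    (\<Sum>i\<in>UNIV. 1/2 * (1 / (2 * l i) / (1 - z / (2 * l i))
       - (b $ i)\<^sup>2 * (1 / (2 * l i)) / (1 - z / (2 * l i))\<^sup>2))"
proof -
  define a where "a i = 1 / (2 * l i)" for i
  have az: "\<bar>a i * z\<bar> < 1" for i using z[of i] by (simp add: a_def)
  have "(\<lambda>k. \<Sum>i\<in>UNIV. 1/2 * (a i * (a i * z) ^ k - (b $ i)\<^sup>2 * a i * (real (Suc k) * (a i * z) ^ k))) sums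
    (\<Sum>i\<in>UNIV. 1/2 * (a i * (1 / (1 - a i * z)) - (b $ i)\<^sup>2 * a i * (1 / (1 - a i * z)\<^sup>2)))"
    using az by (intro sums_sum sums_mult sums_diff geometric_sums geometric_deriv_sums) auto
  moreover have "d_coef l b (Suc k) * z ^ k
     = (\<Sum>i\<in>UNIV. 1/2 * (a i * (a i * z) ^ k - (b $ i)\<^sup>2 * a i * (real (Suc k) * (a i * z) ^ k)))" for k
  proof -
    have inv: "inverse ((2 * l i) ^ Suc k) = a i * a i ^ k" for i
      by (simp add: a_def power_one_over inverse_eq_divide)
    have eq: "1/2 * ((1 - real (Suc k) * (b $ i)\<^sup>2) * (a i * a i ^ k)) * z ^ k
       = 1/2 * (a i * (a i * z) ^ k - (b $ i)\<^sup>2 * a i * (real (Suc k) * (a i * z) ^ k))" for i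
      unfolding power_mult_distrib by algebra
    show ?thesis
      unfolding d_coef_def inv sum_distrib_left sum_distrib_right by (simp only: eq)
  qed
  ultimately show ?thesis
    by (simp add: a_def mult_ac)
qed

text \<open>The exponent is the primitive of the sum in \<open>d_coef_sums\<close>: the logarithm
  comes from the geometric series and the reciprocal from its derivative. Subtracting 1 from the
  reciprocal makes the primitive vanish at 0.\<close>

lemma c_coef_generating_function:
  fixes l :: "'n::finite \<Rightarrow> real" and b :: "real^'n"
  assumes l: "\<And>i. 0 < l i"
  obtains Q where "0 < Q" "\<And>k. \<bar>c_coef l b k\<bar> \<le> c_coef l b 0 * Q ^ k"
    and "\<And>z. \<bar>z\<bar> * Q < 1 \<Longrightarrow> (\<Sum>k. c_coef l b k * z ^ k) = c_coef l b 0 *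
      exp (\<Sum>i\<in>UNIV. - (1/2) * ln (1 - z / (2 * l i)) - 1/2 * (b $ i)\<^sup>2 * (1 / (1 - z / (2 * l i)) - 1))"
proof -
  define A where "A = 1 + (\<Sum>i\<in>UNIV. 1 + (b $ i)\<^sup>2)"
  define q where "q = (\<Sum>i\<in>UNIV. 1 / l i)"
  have A: "1 \<le> A" by (auto simp: A_def intro!: sum_nonneg)
  have q: "0 < q" unfolding q_def using l by (intro sum_pos) auto
  define Q where "Q = A * q"
  have qQ: "q \<le> Q" using mult_right_mono[OF A, of q] q by (simp add: Q_def)
  have Q: "0 < Q" using q qQ by simp
  have rec: "c_coef l b (Suc k) = 1 / real (Suc k) * (\<Sum>j<Suc k. d_coef l b (Suc k - j) * c_coef l b j)" for k
    by (rule c_coef.simps(2))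
  have d: "\<bar>d_coef l b k\<bar> \<le> A * q ^ k" for k
    unfolding A_def q_def by (rule d_coef_bound[OF l])
  have c0: "0 \<le> c_coef l b 0"
    by (auto intro!: mult_nonneg_nonneg prod_nonneg)
  have c: "\<bar>c_coef l b k\<bar> \<le> c_coef l b 0 * Q ^ k" for k
    unfolding Q_def using exp_recursion_bound[of "c_coef l b", OF rec d _ A, of k] c0 q by (simp only: abs_of_nonneg)
  show ?thesis
  proof (rule that[OF Q c])
    fix z assume "\<bar>z\<bar> * Q < 1"
    then have z: "\<bar>z\<bar> < 1 / Q" using Q by (simp add: field_simps)
    \<comment> \<open>Q dominates every 1 / l_i, so |z| < 1/Q \<le> l_i keeps z away from all the
      singularities 2 l_i of the exponent.\<close>
    have small: "\<bar>z / (2 * l i)\<bar> < 1" if "\<bar>z\<bar> < 1 / Q" for z i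
    proof -
      have "1 / l i \<le> q" unfolding q_def using l by (intro member_le_sum) (auto simp: less_imp_le)
      then have "1 / l i \<le> Q" using qQ by simp
      then have "1 / Q \<le> l i" using Q l[of i] by (simp add: field_simps)
      then have "\<bar>z\<bar> < 2 * l i" using that l[of i] by linarith
      then show ?thesis using l[of i] by (simp add: abs_mult)
    qed
    show "(\<Sum>k. c_coef l b k * z ^ k) = c_coef l b 0 *
      exp (\<Sum>i\<in>UNIV. - (1/2) * ln (1 - z / (2 * l i)) - 1/2 * (b $ i)\<^sup>2 * (1 / (1 - z / (2 * l i)) - 1))"
    proof (rule exp_recursion_generating_function[where r = "1 / Q" and d = "d_coef l b", OF rec _ _ _ _ z])
      fix z :: real assume z: "\<bar>z\<bar> < 1 / Q"
      then have zQ: "\<bar>z\<bar> * Q < 1" using Q by (simp add: field_simps)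
      show "summable (\<lambda>k. norm (c_coef l b k * z ^ k))"
        using c Q zQ by (intro summable_power_bound) auto
      show "summable (\<lambda>k. norm (d_coef l b (Suc k) * z ^ k))"
      proof (rule summable_power_bound)
        show "\<bar>d_coef l b (Suc k)\<bar> \<le> (A * q) * q ^ k" for k
          using d[of "Suc k"] by (simp add: mult_ac)
        have "\<bar>z\<bar> * q \<le> \<bar>z\<bar> * Q" by (intro mult_left_mono qQ) simp
        then show "\<bar>z\<bar> * q < 1" using zQ by simp
      qed (use q in simp)
      have pos: "0 < 1 - z / (2 * l i)" for i
        using small[OF z, of i] by linarith
      have E: "((\<lambda>z. \<Sum>i\<in>UNIV. - (1/2) * ln (1 - z / (2 * l i)) - 1/2 * (b $ i)\<^sup>2 * (1 / (1 - z / (2 * l i)) - 1))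
        has_real_derivative (\<Sum>i\<in>UNIV. 1/2 * (1 / (2 * l i) / (1 - z / (2 * l i))
           - (b $ i)\<^sup>2 * (1 / (2 * l i)) / (1 - z / (2 * l i))\<^sup>2))) (at z)"
      proof (rule DERIV_sum)
        fix i :: 'n
        have "((\<lambda>z. 1 - z / (2 * l i)) has_real_derivative - (1 / (2 * l i))) (at z)"
          using l[of i] by (auto intro!: derivative_eq_intros)
        moreover have "((\<lambda>z. - (1/2) * ln (f z) - 1/2 * (b $ i)\<^sup>2 * (1 / f z - 1))
          has_real_derivative 1/2 * (- f' / f z - (b $ i)\<^sup>2 * (- f') / (f z)\<^sup>2)) (at z)"
          if "(f has_real_derivative f') (at z)" "0 < f z" for f f'
          using that(2) by (auto intro!: derivative_eq_intros that(1) simp: power2_eq_square field_simps)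
        ultimately show "((\<lambda>z. - (1/2) * ln (1 - z / (2 * l i)) - 1/2 * (b $ i)\<^sup>2 * (1 / (1 - z / (2 * l i)) - 1))
          has_real_derivative 1/2 * (1 / (2 * l i) / (1 - z / (2 * l i))
           - (b $ i)\<^sup>2 * (1 / (2 * l i)) / (1 - z / (2 * l i))\<^sup>2)) (at z)"
          using pos[of i] by fastforce
      qed
      have S: "(\<Sum>k. d_coef l b (Suc k) * z ^ k) = (\<Sum>i\<in>UNIV. 1/2 * (1 / (2 * l i) / (1 - z / (2 * l i))
           - (b $ i)\<^sup>2 * (1 / (2 * l i)) / (1 - z / (2 * l i))\<^sup>2))"
        using d_coef_sums[of l z b, OF l small[OF z]] by (simp only: sums_iff)
      show "((\<lambda>z. \<Sum>i\<in>UNIV. - (1/2) * ln (1 - z / (2 * l i)) - 1/2 * (b $ i)\<^sup>2 * (1 / (1 - z / (2 * l i)) - 1))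
        has_real_derivative (\<Sum>k. d_coef l b (Suc k) * z ^ k)) (at z)"
        using E by (simp only: S)
    qed simp
  qed
qed

text \<open>At z = -1/t each 1 - z / (2 l_i) equals (1 + 2 t l_i) / (2 t l_i). The denominators
  cancel against the power of t and the factors (2 l_i)^(-1/2) of c_0, while exp (-b_i^2 / 2)
  cancels against the subtracted 1 in the exponent.\<close>

lemma c_coef_generating_function_inverse:
  fixes l :: "'n::finite \<Rightarrow> real" and b :: "real^'n"
  assumes l: "\<And>i. 0 < l i" and t: "0 < t"
  shows "t powr (- (real CARD('n) / 2)) * (c_coef l b 0 *
      exp (\<Sum>i\<in>UNIV. - (1/2) * ln (1 - (- 1 / t) / (2 * l i))
        - 1/2 * (b $ i)\<^sup>2 * (1 / (1 - (- 1 / t) / (2 * l i)) - 1)))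
    = (\<Prod>i\<in>UNIV. (1 + 2 * t * l i) powr (- (1/2)) * exp (- (t * (l i * (b $ i)\<^sup>2) / (1 + 2 * t * l i))))"
proof -
  have "t powr (- (real CARD('n) / 2)) = (\<Prod>i\<in>(UNIV::'n set). t powr (- (1/2)))"
    using t by (simp add: powr_powr flip: powr_realpow)
  moreover have "c_coef l b 0 = (\<Prod>i\<in>UNIV. exp (- (1/2) * (b $ i)\<^sup>2) * (2 * l i) powr (- (1/2)))"
    by (simp only: c_coef.simps sum_distrib_left exp_sum[OF finite] prod.distrib)
  ultimately have "t powr (- (real CARD('n) / 2)) * (c_coef l b 0 *
      exp (\<Sum>i\<in>UNIV. - (1/2) * ln (1 - (- 1 / t) / (2 * l i))
        - 1/2 * (b $ i)\<^sup>2 * (1 / (1 - (- 1 / t) / (2 * l i)) - 1)))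
    = (\<Prod>i\<in>UNIV. t powr (- (1/2)) * (exp (- (1/2) * (b $ i)\<^sup>2) * (2 * l i) powr (- (1/2)) *
        exp (- (1/2) * ln (1 - (- 1 / t) / (2 * l i))
        - 1/2 * (b $ i)\<^sup>2 * (1 / (1 - (- 1 / t) / (2 * l i)) - 1))))"
    by (simp only: exp_sum[OF finite] prod.distrib)
  also have "\<dots> = (\<Prod>i\<in>UNIV. (1 + 2 * t * l i) powr (- (1/2)) * exp (- (t * (l i * (b $ i)\<^sup>2) / (1 + 2 * t * l i))))"
  proof (rule prod.cong)
    fix i :: 'n
    have pos: "0 < 1 + 2 * t * l i" using t l[of i] by (simp add: add_pos_pos)
    have u: "1 - (- 1 / t) / (2 * l i) = (1 + 2 * t * l i) / (t * (2 * l i))"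
      using t l[of i] by (simp add: field_simps)
    have ln: "ln (1 - (- 1 / t) / (2 * l i)) = ln (1 + 2 * t * l i) - (ln t + ln (2 * l i))"
      unfolding u using t l[of i] pos by (simp add: ln_div ln_mult)
    have r: "1 / (1 - (- 1 / t) / (2 * l i)) = t * (2 * l i) / (1 + 2 * t * l i)"
      unfolding u by simp
    have "- (1/2) * ln t + (- (1/2) * (b $ i)\<^sup>2 + - (1/2) * ln (2 * l i) +
        (- (1/2) * (ln (1 + 2 * t * l i) - (ln t + ln (2 * l i)))
          - 1/2 * (b $ i)\<^sup>2 * (t * (2 * l i) / (1 + 2 * t * l i) - 1)))
      = - (1/2) * ln (1 + 2 * t * l i) + - (t * (l i * (b $ i)\<^sup>2) / (1 + 2 * t * l i))"
      by (simp add: algebra_simps)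
    then have "exp (- (1/2) * ln t) * (exp (- (1/2) * (b $ i)\<^sup>2) * exp (- (1/2) * ln (2 * l i)) *
        exp (- (1/2) * (ln (1 + 2 * t * l i) - (ln t + ln (2 * l i)))
          - 1/2 * (b $ i)\<^sup>2 * (t * (2 * l i) / (1 + 2 * t * l i) - 1)))
      = exp (- (1/2) * ln (1 + 2 * t * l i)) * exp (- (t * (l i * (b $ i)\<^sup>2) / (1 + 2 * t * l i)))"
      by (simp only: exp_add[symmetric])
    then show "t powr (- (1/2)) * (exp (- (1/2) * (b $ i)\<^sup>2) * (2 * l i) powr (- (1/2)) *
        exp (- (1/2) * ln (1 - (- 1 / t) / (2 * l i))
        - 1/2 * (b $ i)\<^sup>2 * (1 / (1 - (- 1 / t) / (2 * l i)) - 1)))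
      = (1 + 2 * t * l i) powr (- (1/2)) * exp (- (t * (l i * (b $ i)\<^sup>2) / (1 + 2 * t * l i)))"
      unfolding ln r powr_def using t l[of i] pos by simp
  qed simp
  finally show ?thesis .
qed

subsection \<open>Laplace transforms on the half line\<close>

text \<open>In the variable u = exp (-x) the assumption \<open>zero\<close> says that all moments
  vanish. The support condition keeps u in (0,1], so its powers are bounded and every product with H
  stays integrable.\<close>

lemma integral_polynomial_exp_eq_0:
  fixes H :: "real \<Rightarrow> real"
  assumes H: "integrable lborel H" and supp: "\<And>x. x < 0 \<Longrightarrow> H x = 0"
    and zero: "\<And>j::nat. (LINT x|lborel. exp (- (real j * x)) * H x) = 0"
  shows "(LINT x|lborel. (\<Sum>i\<le>n. a i * exp (- x) ^ i) * H x) = 0"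
proof -
  have [measurable]: "H \<in> borel_measurable borel"
    using borel_measurable_integrable[OF H] by simp
  have int: "integrable lborel (\<lambda>x. exp (- (real j * x)) * H x)" for j :: nat
  proof (rule Bochner_Integration.integrable_bound[OF H])
    show "AE x in lborel. norm (exp (- (real j * x)) * H x) \<le> norm (H x)"
    proof (intro AE_I2)
      show "norm (exp (- (real j * x)) * H x) \<le> norm (H x)" for x
        using supp[of x] by (cases "x < 0") (auto simp: abs_mult intro!: mult_left_le_one_le)
    qed
  qed simp
  have "(LINT x|lborel. (\<Sum>i\<le>n. a i * exp (- x) ^ i) * H x)
     = (LINT x|lborel. (\<Sum>i\<le>n. a i * (exp (- (real i * x)) * H x)))"
    by (simp add: sum_distrib_right exp_of_nat_mult[symmetric] mult.assoc)
  also have "\<dots> = (\<Sum>i\<le>n. a i * (LINT x|lborel. exp (- (real i * x)) * H x))"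
    using int by (subst Bochner_Integration.integral_sum) auto
  finally show ?thesis by (simp add: zero)
qed

text \<open>Replacing f by a polynomial within e on [0,1] changes the integral by at most e times
  the L1 norm of H, and polynomials integrate to zero.\<close>

lemma integral_continuous_exp_eq_0:
  fixes H :: "real \<Rightarrow> real"
  assumes H: "integrable lborel H" and supp: "\<And>x. x < 0 \<Longrightarrow> H x = 0"
    and zero: "\<And>j::nat. (LINT x|lborel. exp (- (real j * x)) * H x) = 0"
    and f: "continuous_on UNIV f"
  shows "integrable lborel (\<lambda>x. f (exp (- x)) * H x)"
    and "(LINT x|lborel. f (exp (- x)) * H x) = (0::real)"
proof -
  have [measurable]: "H \<in> borel_measurable borel"
    using borel_measurable_integrable[OF H] by simp
  have int: "integrable lborel (\<lambda>x. g (exp (- x)) * H x)" if g: "continuous_on UNIV g" for g :: "real \<Rightarrow> real"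
  proof -
    have [measurable]: "g \<in> borel_measurable borel"
      using g by (rule borel_measurable_continuous_onI)
    have "compact (g ` {0..1})"
      using g by (intro compact_continuous_image continuous_on_subset[OF g]) auto
    then obtain K where K: "\<And>u. u \<in> {0..1} \<Longrightarrow> norm (g u) \<le> K"
      by (meson bounded_iff compact_imp_bounded imageI)
    show ?thesis
    proof (rule Bochner_Integration.integrable_bound)
      show "integrable lborel (\<lambda>x. K * H x)" using H by simp
      show "AE x in lborel. norm (g (exp (- x)) * H x) \<le> norm (K * H x)"
      proof (intro AE_I2)
        fix x :: real
        show "norm (g (exp (- x)) * H x) \<le> norm (K * H x)"
        proof (cases "x < 0")
          case False
          then have "norm (g (exp (- x))) \<le> \<bar>K\<bar>" using K[of "exp (- x)"] by simp
          then show ?thesis by (simp add: abs_mult mult_right_mono)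
        qed (simp add: supp)
      qed
    qed simp
  qed
  show "integrable lborel (\<lambda>x. f (exp (- x)) * H x)" by (rule int[OF f])
  define I where "I = (LINT x|lborel. \<bar>H x\<bar>)"
  have I: "0 \<le> I" by (simp add: I_def)
  have small: "\<bar>LINT x|lborel. f (exp (- x)) * H x\<bar> \<le> e * I" if "0 < e" for e
  proof -
    have "\<exists>g. polynomial_function g \<and> (\<forall>u\<in>{0..1}. norm (f u - g u) < e)"
      by (rule Stone_Weierstrass_polynomial_function) (use continuous_on_subset[OF f] that in auto)
    then obtain g :: "real \<Rightarrow> real" where g: "polynomial_function g"
      and ge: "\<And>u. u \<in> {0..1} \<Longrightarrow> norm (f u - g u) < e"
      by blast
    have gc: "continuous_on UNIV g" by (rule continuous_on_polymonial_function[OF g])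
    obtain a n where ga: "g = (\<lambda>x. \<Sum>i\<le>n. a i * x ^ i)"
      using g by (auto simp: real_polynomial_function_eq[symmetric] real_polynomial_function_iff_sum)
    have "(LINT x|lborel. g (exp (- x)) * H x) = 0"
      unfolding ga by (rule integral_polynomial_exp_eq_0[OF H supp zero])
    then have "\<bar>LINT x|lborel. f (exp (- x)) * H x\<bar>
        = norm (LINT x|lborel. f (exp (- x)) * H x - g (exp (- x)) * H x)"
      by (subst Bochner_Integration.integral_diff[OF int[OF f] int[OF gc]]) simp
    also have "\<dots> \<le> (LINT x|lborel. norm (f (exp (- x)) * H x - g (exp (- x)) * H x))"
      by (rule integral_norm_bound)
    also have "\<dots> \<le> (LINT x|lborel. e * \<bar>H x\<bar>)"
    proof (rule integral_mono)
      show "integrable lborel (\<lambda>x. norm (f (exp (- x)) * H x - g (exp (- x)) * H x))"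
        by (intro integrable_norm Bochner_Integration.integrable_diff int f gc)
      show "integrable lborel (\<lambda>x. e * \<bar>H x\<bar>)" using H by simp
      show "norm (f (exp (- x)) * H x - g (exp (- x)) * H x) \<le> e * \<bar>H x\<bar>" for x
      proof (cases "x < 0")
        case False
        then have "\<bar>f (exp (- x)) - g (exp (- x))\<bar> \<le> e" using ge[of "exp (- x)"] by simp
        then show ?thesis by (simp add: abs_mult mult_right_mono flip: left_diff_distrib)
      qed (simp add: supp)
    qed
    finally show ?thesis by (simp add: I_def)
  qed
  show "(LINT x|lborel. f (exp (- x)) * H x) = 0"
  proof (rule ccontr)
    define J where "J = \<bar>LINT x|lborel. f (exp (- x)) * H x\<bar>"
    assume "(LINT x|lborel. f (exp (- x)) * H x) \<noteq> 0"
    then have J: "0 < J" by (simp add: J_def)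
    \<comment> \<open>The denominator 2 (I + 1) makes e I < J and is safe for I = 0.\<close>
    then have "J \<le> J / (2 * (I + 1)) * I" using I by (unfold J_def, intro small) simp
    also have "\<dots> < J" using I J by (simp add: field_simps add_nonneg_pos)
    finally show False by simp
  qed
qed

text \<open>A positive value at y would persist on some interval to the right of y by right
  continuity, and testing against a bump supported there would give a positive integral. The
  one-sided conclusion is applied to a difference in both orders.\<close>

lemma laplace_transform_eq_0_imp_nonpos:
  fixes h :: "real \<Rightarrow> real"
  assumes h: "\<And>t. t > K \<Longrightarrow> has_bochner_integral lborel (\<lambda>x. indicator {0..} x * exp (- (t * x)) * h x) 0"
    and y: "0 \<le> y" and right: "(h \<longlongrightarrow> h y) (at_right y)"
  shows "h y \<le> 0"
proof (rule ccontr)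
  assume "\<not> h y \<le> 0"
  then have "\<forall>\<^sub>F x in at_right y. 0 < h x"
    using order_tendstoD(1)[OF right, of 0] by simp
  then obtain z where z: "y < z" and hz: "\<And>x. y < x \<Longrightarrow> x < z \<Longrightarrow> 0 < h x"
    by (auto simp: eventually_at_right_field)
  \<comment> \<open>The weight at t = |K| + 1 > K makes H integrable, and the transforms at t + j
    become the moments of H.\<close>
  define H where "H x = indicator {0..} x * exp (- ((\<bar>K\<bar> + 1) * x)) * h x" for x
  have H: "integrable lborel H"
    unfolding H_def using h[of "\<bar>K\<bar> + 1"] by (simp add: has_bochner_integral_iff)
  have zero: "(LINT x|lborel. exp (- (real j * x)) * H x) = 0" for j
  proof -
    have "(\<lambda>x. exp (- (real j * x)) * H x) = (\<lambda>x. indicator {0..} x * exp (- ((\<bar>K\<bar> + 1 + real j) * x)) * h x)"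
      by (simp add: H_def fun_eq_iff distrib_right exp_add exp_diff exp_minus field_simps)
    then show ?thesis
      using h[of "\<bar>K\<bar> + 1 + real j"] by (simp add: has_bochner_integral_iff)
  qed
  \<comment> \<open>As a function of u = exp (-x) this is positive exactly for exp (-z) < u < exp
    (-y), that is, for y < x < z.\<close>
  define f where "f u = max 0 ((exp (- y) - u) * (u - exp (- z)))" for u :: real
  have f: "continuous_on UNIV f"
    unfolding f_def by (intro continuous_intros)
  have supp: "H x = 0" if "x < 0" for x using that by (simp add: H_def)
  have f0: "f (exp (- x)) = 0" if "x \<notin> {y<..<z}" for x
  proof -
    have "x \<le> y \<or> z \<le> x" using that by auto
    then have "(exp (- y) - exp (- x)) * (exp (- x) - exp (- z)) \<le> 0"
    proof
      assume "x \<le> y" then show ?thesis using z by (intro mult_nonpos_nonneg) auto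
    next
      assume "z \<le> x" then show ?thesis using z by (intro mult_nonneg_nonpos) auto
    qed
    then show ?thesis by (simp add: f_def)
  qed
  have fp: "0 < f (exp (- x)) * H x" if "x \<in> {y<..<z}" for x
    using that y hz[of x] by (auto simp: f_def H_def less_max_iff_disj intro!: mult_pos_pos)
  have "AE x in lborel. f (exp (- x)) * H x = 0"
  proof (subst integral_nonneg_eq_0_iff_AE[symmetric])
    show "integrable lborel (\<lambda>x. f (exp (- x)) * H x)"
      by (rule integral_continuous_exp_eq_0(1)[OF H supp zero f])
    show "AE x in lborel. 0 \<le> f (exp (- x)) * H x"
    proof (intro AE_I2)
      show "0 \<le> f (exp (- x)) * H x" for x
        using f0[of x] fp[of x] by (cases "x \<in> {y<..<z}") auto
    qed
    show "(LINT x|lborel. f (exp (- x)) * H x) = 0"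
      by (rule integral_continuous_exp_eq_0(2)[OF H supp zero f])
  qed
  then have "AE x in lborel. x \<notin> {y<..<z}"
    by eventually_elim (use fp in fastforce)
  then have "{y<..<z} \<in> null_sets lborel"
    by (subst AE_iff_null_sets) auto
  then have "emeasure lborel {y<..<z} = 0"
    by (rule null_setsD1)
  then show False using z by (simp add: ennreal_eq_0_iff)
qed

lemma laplace_transform_inject:
  fixes f g :: "real \<Rightarrow> real"
  assumes f: "\<And>t. t > K \<Longrightarrow> has_bochner_integral lborel (\<lambda>x. indicator {0..} x * exp (- (t * x)) * f x) (L t)"
    and g: "\<And>t. t > K \<Longrightarrow> has_bochner_integral lborel (\<lambda>x. indicator {0..} x * exp (- (t * x)) * g x) (L t)"
    and y: "0 \<le> y" and "(f \<longlongrightarrow> f y) (at_right y)" "(g \<longlongrightarrow> g y) (at_right y)"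
  shows "f y = g y"
proof (rule order_antisym)
  have "has_bochner_integral lborel (\<lambda>x. indicator {0..} x * exp (- (t * x)) * (f x - g x)) 0" if "t > K" for t
    using has_bochner_integral_diff[OF f[OF that] g[OF that]] by (simp add: right_diff_distrib)
  from laplace_transform_eq_0_imp_nonpos[OF this y tendsto_diff[OF assms(4,5)]]
  show "f y \<le> g y" by simp
  have "has_bochner_integral lborel (\<lambda>x. indicator {0..} x * exp (- (t * x)) * (g x - f x)) 0" if "t > K" for t
    using has_bochner_integral_diff[OF g[OF that] f[OF that]] by (simp add: right_diff_distrib)
  from laplace_transform_eq_0_imp_nonpos[OF this y tendsto_diff[OF assms(5,4)]]
  show "g y \<le> f y" by simp
qed

section \<open>Laplace transforms of powers and of the Gamma series\<close>

text \<open>The substitution of t x in the Gamma integral brings in a Jacobian 1/t and a factor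
  t^(a-1); multiplying by t^(1-a) removes the latter.\<close>

lemma laplace_transform_powr:
  assumes a: "0 < a" and t: "0 < (t::real)"
  shows "has_bochner_integral lborel (\<lambda>x. indicator {0..} x * exp (- (t * x)) * x powr (a - 1)) (t powr (- a) * Gamma a)"
proof -
  define f where "f x = indicator {0..} x * x powr (a - 1) / exp x" for x :: real
  have [measurable]: "f \<in> borel_measurable borel"
    unfolding f_def by measurable
  have "has_bochner_integral lborel f (Gamma a)"
  proof (rule has_bochner_integral_nn_integral)
    show "(\<integral>\<^sup>+x. ennreal (f x) \<partial>lborel) = ennreal (Gamma a)"
      using Gamma_conv_nn_integral_real[OF a] by (simp add: f_def)
    show "0 \<le> Gamma a" using a by simp
  qed (auto simp: f_def)
  then have "has_bochner_integral lborel (\<lambda>x. f (0 + t * x)) (Gamma a /\<^sub>R \<bar>t\<bar>)"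
    using t by (subst (asm) lborel_has_bochner_integral_real_affine_iff[of t _ _ 0]) auto
  then have "has_bochner_integral lborel (\<lambda>x. t powr (1 - a) * f (0 + t * x)) (t powr (1 - a) * (Gamma a /\<^sub>R \<bar>t\<bar>))"
    by (rule has_bochner_integral_mult_right)
  also have "(\<lambda>x. t powr (1 - a) * f (0 + t * x)) = (\<lambda>x. indicator {0..} x * exp (- (t * x)) * x powr (a - 1))"
  proof
    fix x
    have "t powr (1 - a) * t powr (a - 1) = 1" using t by (simp flip: powr_add)
    then have "t powr (1 - a) * (t * x) powr (a - 1) = x powr (a - 1)" if "0 \<le> x"
      using t that by (simp add: powr_mult)
    then show "t powr (1 - a) * f (0 + t * x) = indicator {0..} x * exp (- (t * x)) * x powr (a - 1)"
      using t by (cases "0 \<le> x") (auto simp: f_def indicator_def exp_minus field_simps zero_le_mult_iff)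
  qed
  also have "t powr (1 - a) * (Gamma a /\<^sub>R \<bar>t\<bar>) = t powr (- a) * Gamma a"
    using t by (simp add: powr_diff powr_minus field_simps)
  finally show ?thesis .
qed

text \<open>The functional equation contributes a factor p + j + 1 \<ge> j + 1 at each step. The
  resulting factorial lets the exponential series in Q |x| dominate the Gamma series, which
  therefore converges for every x.\<close>

lemma Gamma_add_nat_ge:
  assumes "0 < (p::real)"
  shows "Gamma (p + real j + 1) \<ge> Gamma (p + 1) * fact j"
proof (induction j)
  case (Suc j)
  have "Gamma (p + real (Suc j) + 1) = (p + real j + 1) * Gamma (p + real j + 1)"
    using Gamma_plus1[of "p + real j + 1"] assms nonpos_Ints_nonpos[of "p + real j + 1"]
    by (auto simp: add_ac)
  also have "\<dots> \<ge> real (Suc j) * (Gamma (p + 1) * fact j)"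
    using Suc assms by (intro mult_mono) auto
  finally show ?case by (simp add: mult_ac)
qed simp

lemma powr_add_nat:
  fixes p x :: real
  assumes "0 < p" "0 \<le> x"
  shows "x powr (p + real j) = x powr p * x ^ j"
  using assms by (cases "x = 0") (auto simp: powr_add powr_realpow)

context
  fixes c :: "nat \<Rightarrow> real" and p K Q :: real
  assumes c: "\<And>j. \<bar>c j\<bar> \<le> K * Q ^ j" and p: "0 < p" and Q: "0 < Q"
begin

lemma geometric_bound_const_nonneg: "0 \<le> K"
  using c[of 0] by simp

lemma gamma_series_summable_abs: "summable (\<lambda>j. \<bar>c j\<bar> * (\<bar>x\<bar> ^ j / Gamma (p + real j + 1)))"
proof (rule summable_comparison_test')
  show "summable (\<lambda>j. K / Gamma (p + 1) * ((Q * \<bar>x\<bar>) ^ j /\<^sub>R fact j))"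
    by (intro summable_mult summable_exp_generic)
  fix j
  have "\<bar>c j\<bar> * (\<bar>x\<bar> ^ j / Gamma (p + real j + 1)) \<le> K * Q ^ j * (\<bar>x\<bar> ^ j / (Gamma (p + 1) * fact j))"
    using c[of j] p Gamma_add_nat_ge[OF p, of j] geometric_bound_const_nonneg Q
    by (intro mult_mono divide_left_mono) (auto intro!: mult_pos_pos)
  also have "\<dots> = K / Gamma (p + 1) * ((Q * \<bar>x\<bar>) ^ j /\<^sub>R fact j)"
    by (simp add: power_mult_distrib field_simps)
  finally show "norm (\<bar>c j\<bar> * (\<bar>x\<bar> ^ j / Gamma (p + real j + 1))) \<le> K / Gamma (p + 1) * ((Q * \<bar>x\<bar>) ^ j /\<^sub>R fact j)"
    using p by (simp add: abs_mult)
qed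

lemma gamma_series_summable:
  assumes "0 \<le> x"
  shows "summable (\<lambda>j. norm ((-1) ^ j * c j * (x powr (p + real j) / Gamma (p + real j + 1))))"
proof -
  have "norm ((-1) ^ j * c j * (x powr (p + real j) / Gamma (p + real j + 1)))
     = x powr p * (\<bar>c j\<bar> * (\<bar>x\<bar> ^ j / Gamma (p + real j + 1)))" for j
    using p assms by (simp add: abs_mult powr_add_nat[OF p] power_abs)
  then show ?thesis
    by (simp only:) (intro summable_mult gamma_series_summable_abs)
qed

lemma gamma_series_isCont:
  assumes "0 < x"
  shows "isCont (\<lambda>x. \<Sum>j. (-1) ^ j * c j * (x powr (p + real j) / Gamma (p + real j + 1))) x"
proof -
  define a where "a j = (-1) ^ j * c j / Gamma (p + real j + 1)" for j
  have sum: "summable (\<lambda>j. a j * z ^ j)" for z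
    by (rule summable_norm_cancel)
      (use gamma_series_summable_abs[of z] p in \<open>simp add: a_def abs_mult power_abs\<close>)
  have "isCont (\<lambda>x. x powr p * (\<Sum>j. a j * x ^ j)) x"
    using assms by (intro continuous_intros isCont_powser_converges_everywhere sum) auto
  \<comment> \<open>Pulling out x^p leaves a power series that converges everywhere. The
    factorization is used only for positive arguments, hence on a neighbourhood of x.\<close>
  moreover have "\<forall>\<^sub>F x in nhds x. x powr p * (\<Sum>j. a j * x ^ j)
     = (\<Sum>j. (-1) ^ j * c j * (x powr (p + real j) / Gamma (p + real j + 1)))"
  proof (rule eventually_mono)
    show "\<forall>\<^sub>F x in nhds x. 0 < x"
      using assms by (intro eventually_nhds_in_open[of "{0<..}", simplified]) auto
    fix x :: real assume "0 < x"
    then show "x powr p * (\<Sum>j. a j * x ^ j) = (\<Sum>j. (-1) ^ j * c j * (x powr (p + real j) / Gamma (p + real j + 1)))"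
      by (subst suminf_mult[OF sum, symmetric]) (simp add: a_def powr_add_nat[OF p] mult_ac)
  qed
  ultimately show ?thesis by (simp only: isCont_cong)
qed

text \<open>In each term the Gamma values cancel. The L1 norms of the terms are, up to a constant,
  dominated by a geometric series of ratio Q / t, so t > Q justifies integrating termwise.\<close>

lemma laplace_transform_gamma_series:
  assumes t: "Q < t"
  shows "has_bochner_integral lborel
    (\<lambda>x. indicator {0..} x * exp (- (t * x)) * (\<Sum>j. (-1) ^ j * c j * (x powr (p + real j) / Gamma (p + real j + 1))))
    (t powr (- p) * (\<Sum>j. c j * (- 1 / t) ^ j) / t)"
proof -
  have t0: "0 < t" using t Q by simp
  define f where "f j x = indicator {0..} x * exp (- (t * x)) * ((-1) ^ j * c j * (x powr (p + real j) / Gamma (p + real j + 1)))" for j x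
  have G: "0 < Gamma (p + real j + 1)" for j using p by (intro Gamma_real_pos) simp
  have tp: "t powr (- (p + real j + 1)) = t powr (- p) / t * (1 / t) ^ j" for j
    using t0 by (simp add: powr_diff powr_minus powr_add powr_realpow field_simps)
  have base: "has_bochner_integral lborel (\<lambda>x. indicator {0..} x * exp (- (t * x)) * x powr (p + real j))
     (t powr (- p) / t * (1 / t) ^ j * Gamma (p + real j + 1))" for j
    using laplace_transform_powr[of "p + real j + 1" t] p t0 unfolding tp by simp
  have f: "has_bochner_integral lborel (f j) (t powr (- p) / t * (c j * (- 1 / t) ^ j))" for j
  proof -
    have "has_bochner_integral lborel (\<lambda>x. (-1) ^ j * c j / Gamma (p + real j + 1) * (indicator {0..} x * exp (- (t * x)) * x powr (p + real j)))
      ((-1) ^ j * c j / Gamma (p + real j + 1) * (t powr (- p) / t * (1 / t) ^ j * Gamma (p + real j + 1)))"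
      by (rule has_bochner_integral_mult_right[OF base])
    also have "(-1) ^ j * c j / Gamma (p + real j + 1) * (t powr (- p) / t * (1 / t) ^ j * Gamma (p + real j + 1))
       = t powr (- p) / t * (c j * ((-1) ^ j * (1 / t) ^ j))"
      using G[of j] by (simp add: field_simps)
    also have "(-1) ^ j * (1 / t) ^ j = (- 1 / t) ^ j"
      by (simp flip: power_mult_distrib)
    also have "(\<lambda>x. (-1) ^ j * c j / Gamma (p + real j + 1) * (indicator {0..} x * exp (- (t * x)) * x powr (p + real j))) = f j"
      by (simp add: f_def fun_eq_iff)
    finally show ?thesis .
  qed
  have nf: "has_bochner_integral lborel (\<lambda>x. norm (f j x)) (t powr (- p) / t * (\<bar>c j\<bar> * (1 / t) ^ j))" for j
  proof -
    have "has_bochner_integral lborel (\<lambda>x. \<bar>c j\<bar> / Gamma (p + real j + 1) * (indicator {0..} x * exp (- (t * x)) * x powr (p + real j)))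
      (\<bar>c j\<bar> / Gamma (p + real j + 1) * (t powr (- p) / t * (1 / t) ^ j * Gamma (p + real j + 1)))"
      by (rule has_bochner_integral_mult_right[OF base])
    also have "\<bar>c j\<bar> / Gamma (p + real j + 1) * (t powr (- p) / t * (1 / t) ^ j * Gamma (p + real j + 1))
       = t powr (- p) / t * (\<bar>c j\<bar> * (1 / t) ^ j)"
      using G[of j] by (simp add: field_simps)
    finally show ?thesis
      using G[of j] by (simp add: f_def abs_mult mult_ac)
  qed
  have ae: "AE x in lborel. summable (\<lambda>j. norm (f j x))"
  proof (intro AE_I2)
    fix x :: real
    show "summable (\<lambda>j. norm (f j x))"
    proof (cases "0 \<le> x")
      case True
      show ?thesis
        unfolding f_def norm_mult[of "indicator {0..} x * exp (- (t * x))"]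
        by (intro summable_mult gamma_series_summable True)
    qed (simp add: f_def)
  qed
  have "summable (\<lambda>j. \<bar>c j\<bar> * (1 / t) ^ j)"
  proof -
    have "summable (\<lambda>j. norm (c j * (1 / t) ^ j))"
    proof (rule summable_comparison_test')
      show "summable (\<lambda>j. K * (Q / t) ^ j)"
        using t t0 Q by (intro summable_mult summable_geometric) simp
      show "norm (norm (c j * (1 / t) ^ j)) \<le> K * (Q / t) ^ j" for j
        using c[of j] t0 by (simp add: abs_mult power_divide field_simps divide_right_mono)
    qed
    then show ?thesis using t0 by (simp add: abs_mult power_abs)
  qed
  then have sm: "summable (\<lambda>j. LINT x|lborel. norm (f j x))"
    using nf by (simp add: has_bochner_integral_iff summable_mult)
  have int: "integrable lborel (f j)" for j using f by (simp add: has_bochner_integral_iff)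
  have "integrable lborel (\<lambda>x. \<Sum>j. f j x)"
    by (rule integrable_suminf[OF int ae sm])
  moreover have "(LINT x|lborel. (\<Sum>j. f j x)) = (\<Sum>j. t powr (- p) / t * (c j * (- 1 / t) ^ j))"
    using f by (subst integral_suminf[OF int ae sm]) (simp add: has_bochner_integral_iff)
  moreover have "(\<Sum>j. t powr (- p) / t * (c j * (- 1 / t) ^ j)) = t powr (- p) * (\<Sum>j. c j * (- 1 / t) ^ j) / t"
  proof -
    have "norm (c j * (- 1 / t) ^ j) = \<bar>c j\<bar> * (1 / t) ^ j" for j
      using t0 by (simp add: abs_mult power_abs)
    then have "summable (\<lambda>j. norm (c j * (- 1 / t) ^ j))"
      using \<open>summable (\<lambda>j. \<bar>c j\<bar> * (1 / t) ^ j)\<close> by (simp only:)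
    from suminf_mult[OF summable_norm_cancel[OF this], of "t powr (- p) / t"]
    show ?thesis by (simp only: times_divide_eq_left)
  qed
  moreover have "(\<lambda>x. \<Sum>j. f j x) = (\<lambda>x. indicator {0..} x * exp (- (t * x)) *
      (\<Sum>j. (-1) ^ j * c j * (x powr (p + real j) / Gamma (p + real j + 1))))"
  proof
    fix x :: real
    show "(\<Sum>j. f j x) = indicator {0..} x * exp (- (t * x)) *
      (\<Sum>j. (-1) ^ j * c j * (x powr (p + real j) / Gamma (p + real j + 1)))"
    proof (cases "0 \<le> x")
      case True
      show ?thesis
        unfolding f_def using summable_norm_cancel[OF gamma_series_summable[OF True]]
        by (rule suminf_mult)
    qed (simp add: f_def)
  qed
  ultimately show ?thesis by (simp add: has_bochner_integral_iff)
qed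

end

section \<open>Laplace transform of a distribution function\<close>

text \<open>Writing the distribution function as the integral of the indicator of y \<le> x and
  exchanging the integrals leaves the integral of exp (-t x) over x \<ge> y. Almost surely y \<ge>
  0, so the restriction to x \<ge> 0 is then automatic.\<close>

lemma laplace_transform_cdf:
  assumes M: "real_distribution M" and nonneg: "AE x in M. 0 \<le> x" and t: "0 < t"
  shows "has_bochner_integral lborel (\<lambda>x. indicator {0..} x * exp (- (t * x)) * cdf M x)
     ((LINT x|M. exp (- (t * x))) / t)"
proof -
  interpret real_distribution M by (rule M)
  interpret pair_sigma_finite lborel M ..
  have inner: "(\<integral>\<^sup>+x. ennreal (exp (- (t * x))) * indicator {y..} x \<partial>lborel) = ennreal (exp (- (t * y)) / t)" for y
  proof -
    have "(\<integral>\<^sup>+x. ennreal (exp (- (t * x))) * indicator {y..} x \<partial>lborel) = ennreal (0 - - (exp (- (t * y)) / t))"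
    proof (rule nn_integral_FTC_atLeast)
      show "((\<lambda>x. - (exp (- (t * x)) / t)) has_real_derivative exp (- (t * x))) (at x)" for x
        using t by (auto intro!: derivative_eq_intros)
      have "filterlim (\<lambda>x. t * x) at_top at_top"
        using t by (intro filterlim_tendsto_pos_mult_at_top[OF tendsto_const] filterlim_ident)
      then have "((\<lambda>x. exp (- (t * x))) \<longlongrightarrow> 0) at_top"
        by (intro filterlim_compose[OF exp_at_bot] filterlim_compose[OF filterlim_uminus_at_bot_at_top])
      then show "((\<lambda>x. - (exp (- (t * x)) / t)) \<longlongrightarrow> 0) at_top"
        using tendsto_minus[OF tendsto_divide[OF _ tendsto_const, of _ 0 _ t]] t by fastforce
    qed auto
    then show ?thesis by simp
  qed
  have int: "integrable M (\<lambda>y. exp (- (t * y)) / t)"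
  proof (rule integrable_const_bound[where B = "1 / t"])
    show "AE y in M. norm (exp (- (t * y)) / t) \<le> 1 / t"
      using nonneg by eventually_elim (use t in \<open>simp add: divide_right_mono\<close>)
  qed simp
  show ?thesis
  proof (rule has_bochner_integral_nn_integral)
    have "(\<integral>\<^sup>+x. ennreal (indicator {0..} x * exp (- (t * x)) * cdf M x) \<partial>lborel)
       = (\<integral>\<^sup>+x. (\<integral>\<^sup>+y. ennreal (exp (- (t * x))) * indicator {0..} x * indicator {..x} y \<partial>M) \<partial>lborel)"
    proof (rule nn_integral_cong)
      fix x :: real
      show "ennreal (indicator {0..} x * exp (- (t * x)) * cdf M x)
         = (\<integral>\<^sup>+y. ennreal (exp (- (t * x))) * indicator {0..} x * indicator {..x} y \<partial>M)"
        by (subst nn_integral_cmult) (auto simp: cdf_def emeasure_eq_measure ennreal_mult indicator_def)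
    qed
    also have "\<dots> = (\<integral>\<^sup>+y. (\<integral>\<^sup>+x. ennreal (exp (- (t * x))) * indicator {0..} x * indicator {..x} y \<partial>lborel) \<partial>M)"
    proof (rule Fubini'[symmetric])
      have "(\<lambda>(x, y). ennreal (exp (- (t * x))) * indicator {0..} x * indicator {..x} y)
         = (\<lambda>(x, y). ennreal (exp (- (t * x))) * indicator {0..} x * indicator {z. snd z \<le> fst z} (x, y))"
        by (auto simp: fun_eq_iff indicator_def)
      then show "(\<lambda>(x, y). ennreal (exp (- (t * x))) * indicator {0..} x * indicator {..x} y)
         \<in> borel_measurable (lborel \<Otimes>\<^sub>M M)"
        by simp measurable
    qed
    also have "\<dots> = (\<integral>\<^sup>+y. ennreal (exp (- (t * y)) / t) \<partial>M)"
    proof (rule nn_integral_cong_AE)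
      show "AE y in M. (\<integral>\<^sup>+x. ennreal (exp (- (t * x))) * indicator {0..} x * indicator {..x} y \<partial>lborel)
          = ennreal (exp (- (t * y)) / t)"
        using nonneg
      proof eventually_elim
        fix y :: real assume "0 \<le> y"
        then have "(\<integral>\<^sup>+x. ennreal (exp (- (t * x))) * indicator {0..} x * indicator {..x} y \<partial>lborel)
          = (\<integral>\<^sup>+x. ennreal (exp (- (t * x))) * indicator {y..} x \<partial>lborel)"
          by (intro nn_integral_cong) (auto simp: indicator_def)
        then show "(\<integral>\<^sup>+x. ennreal (exp (- (t * x))) * indicator {0..} x * indicator {..x} y \<partial>lborel)
          = ennreal (exp (- (t * y)) / t)" by (simp only: inner)
      qed
    qed
    also have "\<dots> = ennreal (LINT y|M. exp (- (t * y)) / t)"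
      using t by (intro nn_integral_eq_integral int) auto
    finally show "(\<integral>\<^sup>+x. ennreal (indicator {0..} x * exp (- (t * x)) * cdf M x) \<partial>lborel)
       = ennreal ((LINT x|M. exp (- (t * x))) / t)" by simp
    show "(\<lambda>x. indicator {0..} x * exp (- (t * x)) * cdf M x) \<in> borel_measurable lborel"
      using borel_measurable_mono[OF monoI[of "cdf M", OF cdf_nondecreasing]] by measurable
  qed (use t cdf_nonneg in \<open>auto intro!: divide_nonneg_pos\<close>)
qed

subsection \<open>The collision probability\<close>

theorem theorem2:
  fixes M :: "'w measure"
    and x s :: "'w \<Rightarrow> real^'n"
    and mu_x mu_s mu b :: "real^'n"
    and Sigma_x Sigma_s Sigma P :: "real^'n^'n"
    and lam :: "'n \<Rightarrow> real"
    and r1 s1 y :: real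
  assumes "prob_space M"
    and "gaussian_vector M x mu_x Sigma_x"
    and "gaussian_vector M s mu_s Sigma_s"
    and "prob_space.indep_var M borel x borel s"
    and "r1 > 0" and "s1 > 0"
    and "Sigma = Sigma_x + Sigma_s"
    and "pd_matrix Sigma"
    and "mu = mu_x - mu_s"
    and "y = (r1 + s1)\<^sup>2"
    and "orthogonal_matrix P"
    and "transpose P ** Sigma ** P = diag_matrix lam"
    and "b = transpose P *v (matrix_inv (matrix_sqrt Sigma) *v mu)"
  shows "(\<lambda>j. (-1) ^ j * c_coef lam b j *
            (y powr (real CARD('n) / 2 + real j) / Gamma (real CARD('n) / 2 + real j + 1)))
         sums measure M {w \<in> space M. (norm (x w - s w))\<^sup>2 \<le> (r1 + s1)\<^sup>2}"
proof -
  interpret prob_space M by (rule assms(1))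
  define X where "X w = x w - s w" for w
  define p where "p = real CARD('n) / 2"
  have p: "0 < p" by (simp add: p_def)
  have meas [measurable]: "x \<in> borel_measurable M" "s \<in> borel_measurable M"
    using assms(2,3) by (auto simp: gaussian_vector_def)
  have X [measurable]: "X \<in> borel_measurable M"
    unfolding X_def by measurable
  have lam: "0 < lam i" for i
    using pd_matrix_eigenvalues_pos assms(8,11,12) by blast
  have char: "(CLINT w|M. iexp (u \<bullet> X w))
      = exp (\<i> * complex_of_real (u \<bullet> mu) - complex_of_real (u \<bullet> (Sigma *v u) / 2))" for u
    unfolding X_def assms(7,9) by (rule char_diff_gaussian_vector[OF assms(2-4)])
  \<comment> \<open>This turns the standardized mean in the coefficients c_k into the rotated mean
    in the Laplace transform of |x - s|^2.\<close>
  have b: "lam i * (b $ i)\<^sup>2 = ((transpose P *v mu) $ i)\<^sup>2" for i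
    using standardized_mean_component[OF assms(8,11,12), of mu i] lam[of i]
    by (simp only: assms(13) power_divide real_sqrt_pow2 less_imp_le) simp
  define Lt where "Lt t = (\<Prod>i\<in>UNIV. (1 + 2 * t * lam i) powr (- (1/2))
      * exp (- (t * ((transpose P *v mu) $ i)\<^sup>2 / (1 + 2 * t * lam i))))" for t
  define N where "N = distr M borel (\<lambda>w. (norm (X w))\<^sup>2)"
  interpret N: real_distribution N
    unfolding N_def by (intro real_distribution_distr) simp
  have nonneg: "AE r in N. 0 \<le> r"
    unfolding N_def by (subst AE_distr_iff) auto
  have cdf_laplace: "has_bochner_integral lborel (\<lambda>r. indicator {0..} r * exp (- (t * r)) * cdf N r) (Lt t / t)"
    if "0 < t" for t
  proof -
    have "(LINT r|N. exp (- (t * r))) = (LINT w|M. exp (- (t * (norm (X w))\<^sup>2)))"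
      unfolding N_def by (subst integral_distr) auto
    also have "\<dots> = Lt t"
      unfolding Lt_def using that lam
      by (intro laplace_transform_norm_square[OF X char assms(11,12)]) (auto simp: less_imp_le)
    finally show ?thesis
      using laplace_transform_cdf[OF N.real_distribution_axioms nonneg that] by simp
  qed
  obtain Q where Q: "0 < Q" and c: "\<And>k. \<bar>c_coef lam b k\<bar> \<le> c_coef lam b 0 * Q ^ k"
    and gen: "\<And>z. \<bar>z\<bar> * Q < 1 \<Longrightarrow> (\<Sum>k. c_coef lam b k * z ^ k) = c_coef lam b 0 *
      exp (\<Sum>i\<in>UNIV. - (1/2) * ln (1 - z / (2 * lam i)) - 1/2 * (b $ i)\<^sup>2 * (1 / (1 - z / (2 * lam i)) - 1))"
    using c_coef_generating_function[of lam b, OF lam] by blast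
  define F where "F r = (\<Sum>j. (-1) ^ j * c_coef lam b j * (r powr (p + real j) / Gamma (p + real j + 1)))" for r
  have series_laplace: "has_bochner_integral lborel (\<lambda>r. indicator {0..} r * exp (- (t * r)) * F r) (Lt t / t)"
    if t: "Q < t" for t
  proof -
    have t0: "0 < t" using t Q by simp
    \<comment> \<open>The condition t > Q places z = -1/t inside the disc on which the closed form
      of the generating function holds.\<close>
    then have "\<bar>- 1 / t\<bar> * Q < 1" using t by simp
    then have "t powr (- p) * (\<Sum>k. c_coef lam b k * (- 1 / t) ^ k) = Lt t"
      using c_coef_generating_function_inverse[of lam t b, OF lam t0]
      by (simp only: gen p_def Lt_def b)
    then show ?thesis
      using laplace_transform_gamma_series[OF c p Q t] by (simp only: F_def)
  qed
  have y: "0 < y" using assms(5,6,10) by simp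
  have "F y = cdf N y"
  proof (rule laplace_transform_inject[where f = F and g = "cdf N" and K = Q and L = "\<lambda>t. Lt t / t"])
    show "has_bochner_integral lborel (\<lambda>r. indicator {0..} r * exp (- (t * r)) * cdf N r) (Lt t / t)"
      if "Q < t" for t
      using cdf_laplace that Q by simp
    show "has_bochner_integral lborel (\<lambda>r. indicator {0..} r * exp (- (t * r)) * F r) (Lt t / t)"
      if "Q < t" for t
      by (rule series_laplace[OF that])
    have "isCont F y"
      unfolding F_def by (rule gamma_series_isCont[OF c p Q y])
    then show "(F \<longlongrightarrow> F y) (at_right y)"
      by (simp add: isCont_def filterlim_at_split)
    show "(cdf N \<longlongrightarrow> cdf N y) (at_right y)"
      using N.cdf_is_right_cont[of y] by (simp add: continuous_within)
  qed (use y in simp)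
  moreover have "cdf N y = measure M {w \<in> space M. (norm (x w - s w))\<^sup>2 \<le> (r1 + s1)\<^sup>2}"
    unfolding cdf_def N_def
    by (subst measure_distr) (auto simp: X_def assms(10) intro!: arg_cong[where f = "measure M"])
  moreover have "(\<lambda>j. (-1) ^ j * c_coef lam b j * (y powr (p + real j) / Gamma (p + real j + 1))) sums F y"
    unfolding F_def
    using summable_norm_cancel[OF gamma_series_summable[OF c p Q less_imp_le[OF y]]]
    by (rule summable_sums)
  ultimately show ?thesis
    by (simp only: p_def)
qed

end
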